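(* Let $f$ be an even log-concave probability density on $\mathbb{R}^n$, let $\mu=f\,d\mathrm{mes}_n$, let $\lambda$ be the restriction of Lebesgue measure to $K_f$, and let $T=T_f$ be the canonical radial map with $T_*\mu=\lambda$. Then $K_f$ is a symmetric convex body, and, viewing $T$ as a map of the normed space $V=(\mathbb{R}^n,\|\cdot\|_{K_f})$ into itself, $$\|T\|_{\mathrm{Lip}}\ \le\ C\,f(0)^{1/n},$$ where $C>0$ is a universal constant.
   Context: For an integrable $f\ge0$ on $\mathbb{R}^n$ set $\|x\|_{K_f}=\big(n\int_0^\infty f(rx)r^{n-1}\,dr\big)^{-1/n}$ and $K_f=\{x\in\mathbb{R}^n:\|x\|_{K_f}\le1\}$. The canonical radial map $T_f$ is defined by $T_f(0)=0$ and, for $x\neq0$, $$T_f(x)=\Big(\frac{\int_0^1 f(rx)r^{n-1}dr}{\int_0^\infty f(rx)r^{n-1}dr}\Big)^{1/n}\frac{x}{\|x\|_{K_f}}.$$ A map $T$ pushes $\mu$ forward to $\lambda$ ($T_*\mu=\lambda$) if $\mu(T^{-1}(B))=\lambda(B)$ for all Borel $B$. $\|T\|_{\mathrm{Lip}}=\sup_{x\ne y}\|T(x)-T(y)\|/\|x-y\|$. *)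

theory Defs
  imports "HOL-Analysis.Analysis"
begin

text \<open>Euclidean space R^n is modelled as the subspace Rn n of nat => real consisting of
the functions vanishing outside the index set {..<n}.  This explicit carrier is needed
because the dimension n is quantified inside the statement (the constant C is universal).\<close>

definition Rn :: "nat \<Rightarrow> (nat \<Rightarrow> real) set" where
  "Rn n = {x. \<forall>i\<ge>n. x i = 0}"

definition vzero :: "nat \<Rightarrow> real" where
  "vzero = (\<lambda>i. 0)"

definition vscale :: "real \<Rightarrow> (nat \<Rightarrow> real) \<Rightarrow> (nat \<Rightarrow> real)" where
  "vscale r x = (\<lambda>i. r * x i)"

definition vadd :: "(nat \<Rightarrow> real) \<Rightarrow> (nat \<Rightarrow> real) \<Rightarrow> (nat \<Rightarrow> real)" where
  "vadd x y = (\<lambda>i. x i + y i)"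

definition vdiff :: "(nat \<Rightarrow> real) \<Rightarrow> (nat \<Rightarrow> real) \<Rightarrow> (nat \<Rightarrow> real)" where
  "vdiff x y = (\<lambda>i. x i - y i)"

definition vneg :: "(nat \<Rightarrow> real) \<Rightarrow> (nat \<Rightarrow> real)" where
  "vneg x = (\<lambda>i. - x i)"

definition enorm :: "nat \<Rightarrow> (nat \<Rightarrow> real) \<Rightarrow> real" where
  "enorm n x = sqrt (\<Sum>i<n. (x i)\<^sup>2)"

definition lebesgue_n :: "nat \<Rightarrow> (nat \<Rightarrow> real) measure" where
  "lebesgue_n n = completion (distr (PiM {..<n} (\<lambda>_. lborel)) (PiM UNIV (\<lambda>_. borel))
                     (\<lambda>x i. if i < n then x i else 0))"

definition log_concave_on :: "nat \<Rightarrow> ((nat \<Rightarrow> real) \<Rightarrow> real) \<Rightarrow> bool" where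
  "log_concave_on n f \<longleftrightarrow> (\<forall>x\<in>Rn n. \<forall>y\<in>Rn n. \<forall>t::real. 0 < t \<and> t < 1 \<longrightarrow>
      f (vadd (vscale (1 - t) x) (vscale t y)) \<ge> f x powr (1 - t) * f y powr t)"

definition rad_int :: "nat \<Rightarrow> ((nat \<Rightarrow> real) \<Rightarrow> real) \<Rightarrow> real set \<Rightarrow> (nat \<Rightarrow> real) \<Rightarrow> ennreal" where
  "rad_int n f A x = (\<integral>\<^sup>+ r \<in> A. ennreal (f (vscale r x) * r ^ (n - 1)) \<partial>lebesgue)"

text \<open>The gauge ||x||_{K_f} = (n int_0^oo f(rx) r^(n-1) dr)^(-1/n), with the convention
oo^(-1/n) = 0 (this happens only for x = 0).\<close>
definition Kf_norm :: "nat \<Rightarrow> ((nat \<Rightarrow> real) \<Rightarrow> real) \<Rightarrow> (nat \<Rightarrow> real) \<Rightarrow> real" where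
  "Kf_norm n f x = (if rad_int n f {0..} x = \<infinity> then 0
                    else (real n * enn2real (rad_int n f {0..} x)) powr (- 1 / real n))"

definition Kf :: "nat \<Rightarrow> ((nat \<Rightarrow> real) \<Rightarrow> real) \<Rightarrow> (nat \<Rightarrow> real) set" where
  "Kf n f = {x \<in> Rn n. Kf_norm n f x \<le> 1}"

definition Tf :: "nat \<Rightarrow> ((nat \<Rightarrow> real) \<Rightarrow> real) \<Rightarrow> (nat \<Rightarrow> real) \<Rightarrow> (nat \<Rightarrow> real)" where
  "Tf n f x = (if x = vzero then vzero
     else vscale ((enn2real (rad_int n f {0..1} x) / enn2real (rad_int n f {0..} x)) powr (1 / real n)
                  / Kf_norm n f x) x)"

definition symmetric_convex_body :: "nat \<Rightarrow> (nat \<Rightarrow> real) set \<Rightarrow> bool" where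
  "symmetric_convex_body n K \<longleftrightarrow>
     K \<subseteq> Rn n \<and> compact K \<and>
     (\<forall>x\<in>K. \<forall>y\<in>K. \<forall>t::real. 0 \<le> t \<and> t \<le> 1 \<longrightarrow> vadd (vscale (1 - t) x) (vscale t y) \<in> K) \<and>
     (\<forall>x\<in>K. vneg x \<in> K) \<and>
     (\<exists>e>0. \<forall>x\<in>Rn n. enorm n x < e \<longrightarrow> x \<in> K)"

end

theory Submission
  imports Defs
begin

text \<open>The map is \<open>T x = a(x) x\<close> with \<open>a(x) = (n \<integral>\<^sub>0\<^sup>1 f(rx) r\<^bsup>n-1\<^esup> dr)\<^bsup>1/n\<^esup>\<close>.  By Ball's theorem the gauge
  of \<open>K\<^sub>f\<close> is a norm \<open>N\<close>; it rests on a one-dimensional inequality of Prekopa-Leindler type with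
  harmonic means, proved by transporting the two radial densities to the unit interval.  Applied to
  \<open>f(x) 1(|u| \<le> 1)\<close> with one additional coordinate \<open>u\<close>, the same inequality yields
  \<open>|1/a(x) - 1/a(y)| \<le> N(x - y)\<close>.  As \<open>a \<le> f(0)\<^bsup>1/n\<^esup>\<close> and \<open>a(y) N(y) \<le> 1\<close>, this gives
  \<open>N(Tx - Ty) \<le> a(x) N(x - y) + |a(x) - a(y)| N(y) \<le> 2 f(0)\<^bsup>1/n\<^esup> N(x - y)\<close>.

  The integral of \<open>f\<close>, which is not assumed measurable, is used only as a lower integral: positivity
  makes \<open>f\<close> bounded below near the origin, and finiteness makes it decay exponentially, which
  compares \<open>N\<close> with the coordinates.\<close>

section \<open>Ball's one-dimensional inequality\<close>

text \<open>The harmonic mean comes from geometry: the segment from r x to s y meets the ray through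
  x + y at the parameter rs/(r+s), and log-concavity along that segment is the hypothesis of the
  one-dimensional inequality. The number n enters that inequality only through the weight r^(n-1),
  independently of the dimension of the vectors, so a coordinate can be added while the exponent
  stays n. The triangle inequality concerns 1/a and not a because a gauge is an integral to the
  power -1/n; returning to a costs a factor a(x) a(y), and its second half is what tames the
  unbounded N(y). The transport maps are differentiated only where the radial densities are positive
  and continuous, whereas r^(n-1) may vanish at 0 and a profile may jump at the end of its support;
  therefore the inequality is proved on compact intervals first and the general case is a
  limit.\<close>

lemma harmonic_transport_inequality:
  fixes A B G H r s \<mu> :: real and n :: nat
  assumes n: "n \<ge> 1" and pos: "A > 0" "B > 0" "G > 0" "H > 0" "r > 0" "s > 0"
    and \<mu>: "G powr (s / (r + s)) * H powr (r / (r + s)) \<le> \<mu>"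
  defines "t \<equiv> r * s / (r + s)"
  defines "t' \<equiv> (s\<^sup>2 * (A / (G * r ^ (n - 1))) + r\<^sup>2 * (B / (H * s ^ (n - 1)))) / (r + s)\<^sup>2"
  shows "(A powr (- 1 / n) + B powr (- 1 / n)) powr (- real n) \<le> \<mu> * t ^ (n - 1) * t'"
proof -
  \<comment> \<open>\<open>t'\<close> is the derivative of t = 1/(1/r + 1/s) when \<open>r\<close>
    and \<open>s\<close> move with the speeds A/(G r^(n-1)) and B/(H s^(n-1)) of a transport from
    the uniform measure. Two weighted AM-GM inequalities with the weights \<open>w\<close> and
    \<open>v\<close> give the claim; all powers of \<open>r\<close>, \<open>s\<close>,
    \<open>G\<close> and \<open>H\<close> cancel between them.\<close>
  define w v where "w = s / (r + s)" and "v = r / (r + s)"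
  have rs: "r + s > 0" using pos by simp
  have w: "w > 0" "v > 0" "w + v = 1" "t = w * r" "t = v * s" "t > 0"
    using pos rs by (auto simp: w_def v_def t_def simp flip: add_divide_distrib)
  \<comment> \<open>\<open>a\<close> and \<open>b\<close> are the logarithmic speeds of
    \<open>r\<close> and \<open>s\<close>, so the logarithmic derivative t'/t is their mean
    \<open>w * a + v * b\<close>.\<close>
  define a b where "a = A / (G * r ^ n)" and "b = B / (H * s ^ n)"
  have ab: "a > 0" "b > 0" using pos by (auto simp: a_def b_def)
  have rn: "r ^ n = r * r ^ (n - 1)" "s ^ n = s * s ^ (n - 1)" "t ^ n = t * t ^ (n - 1)"
    using n by (metis One_nat_def Suc_pred less_eq_Suc_le power_Suc)+
  have "A / (G * r ^ (n - 1)) = a * r" "B / (H * s ^ (n - 1)) = b * s"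
    using pos by (auto simp: a_def b_def rn)
  then have "t' = w * (w * r) * a + v * (v * s) * b"
    by (simp add: t'_def w_def v_def add_divide_distrib power2_eq_square algebra_simps)
  then have "t' = w * t * a + v * t * b"
    by (simp only: w(4)[symmetric] w(5)[symmetric])
  then have "t' = t * (w * a + v * b)" by (simp add: algebra_simps)
  then have *: "t ^ (n - 1) * t' = t ^ n * (w * a + v * b)" by (simp add: rn)
  define \<alpha> \<beta> where "\<alpha> = A powr (- 1 / n)" and "\<beta> = B powr (- 1 / n)"
  have al: "\<alpha> > 0" "\<beta> > 0" using pos by (auto simp: \<alpha>_def \<beta>_def)
  have young: "(\<alpha> / w) powr w * (\<beta> / v) powr v \<le> \<alpha> + \<beta>"
    using Youngs_inequality_0[of w v "\<alpha> / w" "\<beta> / v"] w al by auto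
  have Aa: "A = \<alpha> powr (- real n)" "B = \<beta> powr (- real n)"
    using n pos by (auto simp: \<alpha>_def \<beta>_def powr_powr)
  have e1: "ln A = - real n * ln \<alpha>" "ln B = - real n * ln \<beta>"
    using al by (simp_all add: Aa ln_powr)
  have "(\<alpha> + \<beta>) powr (- real n) \<le> ((\<alpha> / w) powr w * (\<beta> / v) powr v) powr (- real n)"
    using young al w by (intro powr_mono2') auto
  also have "\<dots> = (G powr w * H powr v) * (t ^ n * (a powr w * b powr v))"
  proof -
    have L: "ln (((\<alpha> / w) powr w * (\<beta> / v) powr v) powr (- real n)) =
        - real n * (w * (ln \<alpha> - ln w) + v * (ln \<beta> - ln v))"
      using al w by (simp add: ln_powr ln_mult ln_div)
    have la: "ln a = ln A - ln G - n * ln r" "ln b = ln B - ln H - n * ln s"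
      using pos by (simp_all add: a_def b_def ln_mult ln_div ln_realpow)
    \<comment> \<open>The two representations t = w r = v s are used with the weights
      \<open>w\<close> and \<open>v\<close>; the terms in ln r and ln s then cancel against those of
      \<open>la\<close>.\<close>
    have lt: "ln t = w * (ln w + ln r) + v * (ln v + ln s)"
    proof -
      have "ln t = ln w + ln r" "ln t = ln v + ln s"
        using w pos ln_mult[of w r] ln_mult[of v s] by auto
      then have "w * (ln w + ln r) + v * (ln v + ln s) = (w + v) * ln t"
        by (simp add: algebra_simps)
      then show ?thesis using w by simp
    qed
    have "ln ((G powr w * H powr v) * (t ^ n * (a powr w * b powr v))) =
       w * ln G + v * ln H + (n * ln t + (w * ln a + v * ln b))"
      using al w ab pos by (simp add: ln_powr ln_mult ln_realpow)
    also have "\<dots> = - real n * (w * (ln \<alpha> - ln w) + v * (ln \<beta> - ln v))"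
      unfolding la lt e1 by (simp add: algebra_simps)
    finally have "ln (((\<alpha> / w) powr w * (\<beta> / v) powr v) powr (- real n)) =
       ln ((G powr w * H powr v) * (t ^ n * (a powr w * b powr v)))" using L by simp
    then show ?thesis using al w ab pos by (subst (asm) ln_inj_iff) auto
  qed
  also have "\<dots> \<le> \<mu> * (t ^ n * (w * a + v * b))"
  proof (intro mult_mono)
    show "G powr w * H powr v \<le> \<mu>" using \<mu> by (simp add: w_def v_def)
    then show "0 \<le> \<mu>" using pos by (smt (verit) mult_nonneg_nonneg powr_ge_zero)
    show "a powr w * b powr v \<le> w * a + v * b"
      using Youngs_inequality_0[of w v a b] w ab by auto
  qed (use w ab in auto)
  also have "\<dots> = \<mu> * t ^ (n - 1) * t'" using * by simp
  finally show ?thesis by (simp add: \<alpha>_def \<beta>_def)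
qed

text \<open>The map inverts the normalised primitive of \<open>q\<close>. It is differentiated only
  on the open interval, since the intended \<open>q\<close>, namely g(r) r^(n-1), may vanish at 0,
  where the inverse may have infinite slope.\<close>

lemma uniform_transport:
  fixes q :: "real \<Rightarrow> real"
  assumes a: "a > 0" and q: "continuous_on {0..a} q" "\<And>r. 0 < r \<Longrightarrow> r \<le> a \<Longrightarrow> q r > 0"
  defines "A \<equiv> integral {0..a} q"
  shows "A > 0"
    and "\<exists>\<rho>. \<forall>u\<in>{0<..<1}. \<rho> u \<in> {0<..<a} \<and> (\<rho> has_real_derivative A / q (\<rho> u)) (at u)"
proof -
  define Q where "Q = (\<lambda>r. integral {0..r} q)"
  have dQ: "(Q has_real_derivative q r) (at r within {0..a})" if "r \<in> {0..a}" for r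
    unfolding Q_def using integral_has_real_derivative[OF q(1) that] .
  have cQ: "continuous_on {0..a} Q"
    using dQ by (meson DERIV_continuous continuous_on_eq_continuous_within)
  have dQ': "(Q has_real_derivative q r) (at r)" if "0 < r" "r < a" for r
    using dQ[of r] that by (simp add: at_within_Icc_at)
  have mono: "Q r < Q s" if "0 \<le> r" "r < s" "s \<le> a" for r s
  proof (rule DERIV_pos_imp_increasing_open[OF that(2)])
    show "\<exists>y. DERIV Q x :> y \<and> 0 < y" if "r < x" "x < s" for x
      using that \<open>0 \<le> r\<close> \<open>s \<le> a\<close> dQ'[of x] q(2)[of x] by auto
    show "continuous_on {r..s} Q"
      using cQ by (rule continuous_on_subset) (use that in auto)
  qed
  have Q0: "Q 0 = 0" and Qa: "Q a = A" by (auto simp: Q_def A_def)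
  show A: "A > 0" using mono[of 0 a] a Q0 Qa by auto
  have inj: "inj_on Q {0..a}"
    by (rule linorder_inj_onI) (use mono in force)+
  define R where "R = the_inv_into {0..a} Q"
  have img: "Q ` {0..a} = {0..A}"
  proof
    show "Q ` {0..a} \<subseteq> {0..A}"
      using mono Q0 Qa by (smt (verit) atLeastAtMost_iff image_subset_iff)
    show "{0..A} \<subseteq> Q ` {0..a}"
      using IVT'[of Q 0 _ a] Q0 Qa cQ a by (force simp: image_iff)
  qed
  have cR: "continuous_on {0..A} R"
    using continuous_on_inv_into[OF cQ _ inj] img by (simp add: R_def)
  have QR: "Q (R y) = y" "R y \<in> {0..a}" if "y \<in> {0..A}" for y
    using that f_the_inv_into_f[OF inj] the_inv_into_into[OF inj, of y "{0..a}"] img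
    by (auto simp: R_def)
  have Rint: "R y \<in> {0<..<a}" if "0 < y" "y < A" for y
    using QR[of y] that Q0 Qa by (auto simp: less_le)
  have dR: "(R has_real_derivative inverse (q (R y))) (at y)" if "0 < y" "y < A" for y
  proof (rule DERIV_inverse_function[where a=0 and b=A])
    show "DERIV Q (R y) :> q (R y)" using dQ' Rint[OF that] by auto
    show "q (R y) \<noteq> 0" using q(2)[of "R y"] Rint[OF that] by auto
    show "Q (R z) = z" if "0 < z" "z < A" for z using QR that by auto
    show "isCont R y"
      using cR that by (metis at_within_Icc_at atLeastAtMost_iff continuous_on_eq_continuous_within less_eq_real_def)
  qed (use that in auto)
  show "\<exists>\<rho>. \<forall>u\<in>{0<..<1}. \<rho> u \<in> {0<..<a} \<and> (\<rho> has_real_derivative A / q (\<rho> u)) (at u)"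
  proof (intro exI[of _ "\<lambda>u. R (u * A)"] ballI conjI)
    fix u :: real assume "u \<in> {0<..<1}"
    then have u: "0 < u * A" "u * A < A" using A by auto
    show "R (u * A) \<in> {0<..<a}" using Rint[OF u] .
    show "((\<lambda>u. R (u * A)) has_real_derivative A / q (R (u * A))) (at u)"
      using DERIV_chain2[where f=R and g="\<lambda>u. u * A", OF dR[OF u] DERIV_cmult_right[OF DERIV_ident]]
      by (simp add: field_simps)
  qed
qed

text \<open>Let \<tau>(u) couple the points that the two transports assign to the same u.
  Substituting t = \<tau>(u) bounds the integral of \<open>m\<close> from below by an integral over
  (0,1) whose integrand is at least the constant on the left.\<close>

lemma Ball_inequality_compact:
  fixes g h m :: "real \<Rightarrow> real" and n :: nat
  assumes n: "n \<ge> 1" and ab: "a > 0" "b > 0"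
    and g: "continuous_on {0..a} g" "\<And>r. 0 \<le> r \<Longrightarrow> r \<le> a \<Longrightarrow> g r > 0"
    and h: "continuous_on {0..b} h" "\<And>r. 0 \<le> r \<Longrightarrow> r \<le> b \<Longrightarrow> h r > 0"
    and m: "\<And>r. m r \<ge> 0" "set_borel_measurable borel {0..} m"
    and ghm: "\<And>r s. r > 0 \<Longrightarrow> s > 0 \<Longrightarrow>
      g r powr (s / (r + s)) * h s powr (r / (r + s)) \<le> m (r * s / (r + s))"
  defines "A \<equiv> integral {0..a} (\<lambda>r. g r * r ^ (n - 1))"
    and "B \<equiv> integral {0..b} (\<lambda>r. h r * r ^ (n - 1))"
  shows "A > 0" "B > 0"
    "ennreal ((A powr (- 1 / n) + B powr (- 1 / n)) powr (- real n))
      \<le> (\<integral>\<^sup>+t\<in>{0..}. ennreal (m t * t ^ (n - 1)) \<partial>lborel)"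
proof -
  have cg: "continuous_on {0..a} (\<lambda>r. g r * r ^ (n - 1))" "continuous_on {0..b} (\<lambda>r. h r * r ^ (n - 1))"
    using g h by (auto intro!: continuous_intros)
  have pg: "0 < r \<Longrightarrow> r \<le> a \<Longrightarrow> g r * r ^ (n - 1) > 0" "0 < r \<Longrightarrow> r \<le> b \<Longrightarrow> h r * r ^ (n - 1) > 0" for r
    using g(2)[of r] h(2)[of r] by auto
  note tr1 = uniform_transport[OF ab(1) cg(1) pg(1), folded A_def]
  note tr2 = uniform_transport[OF ab(2) cg(2) pg(2), folded B_def]
  show AB: "A > 0" "B > 0" using tr1(1) tr2(1) by auto
  obtain \<rho> where \<rho>: "\<And>u. u \<in> {0<..<1} \<Longrightarrow> \<rho> u \<in> {0<..<a}"
     "\<And>u. u \<in> {0<..<1} \<Longrightarrow> (\<rho> has_real_derivative A / (g (\<rho> u) * \<rho> u ^ (n - 1))) (at u)"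
    using tr1(2) by blast
  obtain \<sigma> where \<sigma>: "\<And>u. u \<in> {0<..<1} \<Longrightarrow> \<sigma> u \<in> {0<..<b}"
     "\<And>u. u \<in> {0<..<1} \<Longrightarrow> (\<sigma> has_real_derivative B / (h (\<sigma> u) * \<sigma> u ^ (n - 1))) (at u)"
    using tr2(2) by blast
  define \<tau> where "\<tau> = (\<lambda>u. \<rho> u * \<sigma> u / (\<rho> u + \<sigma> u))"
  define \<tau>' where "\<tau>' = (\<lambda>u. ((\<sigma> u)\<^sup>2 * (A / (g (\<rho> u) * \<rho> u ^ (n - 1))) +
      (\<rho> u)\<^sup>2 * (B / (h (\<sigma> u) * \<sigma> u ^ (n - 1)))) / (\<rho> u + \<sigma> u)\<^sup>2)"
  define K where "K = (A powr (- 1 / n) + B powr (- 1 / n)) powr (- real n)"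
  define X where "X = (\<integral>\<^sup>+t\<in>{0..}. ennreal (m t * t ^ (n - 1)) \<partial>lborel)"
  have K0: "K > 0" using AB add_pos_pos[of "A powr (- 1 / n)" "B powr (- 1 / n)"] by (simp add: K_def)
  have pos: "\<rho> u > 0" "\<sigma> u > 0" "g (\<rho> u) > 0" "h (\<sigma> u) > 0" if "u \<in> {0<..<1}" for u
    using \<rho>(1)[OF that] \<sigma>(1)[OF that] g(2)[of "\<rho> u"] h(2)[of "\<sigma> u"] by auto
  have d\<tau>: "(\<tau> has_real_derivative \<tau>' u) (at u)" if "u \<in> {0<..<1}" for u
  proof -
    have "\<rho> u + \<sigma> u \<noteq> 0" using pos[OF that] by auto
    then show ?thesis unfolding \<tau>_def \<tau>'_def
      by (auto intro!: derivative_eq_intros \<rho>(2)[OF that] \<sigma>(2)[OF that] simp del: times_divide_eq_right times_divide_eq_left)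
        (simp add: algebra_simps add_divide_distrib power2_eq_square)
  qed
  have \<tau>'0: "\<tau>' u \<ge> 0" if "u \<in> {0<..<1}" for u
    using pos[OF that] AB unfolding \<tau>'_def by auto
  have \<tau>0: "\<tau> u > 0" if "u \<in> {0<..<1}" for u
    using pos[OF that] unfolding \<tau>_def by auto
  have key: "K \<le> m (\<tau> u) * \<tau> u ^ (n - 1) * \<tau>' u" if "u \<in> {0<..<1}" for u
    unfolding K_def \<tau>_def \<tau>'_def
    using harmonic_transport_inequality[OF n AB pos(3,4,1,2)[OF that] ghm[OF pos(1,2)[OF that]]] .
  \<comment> \<open>The derivatives are known only inside (0,1), so the substitution is made on an
    interval \<open>{c..d}\<close> of length \<open>z\<close> centred at 1/2, and \<open>z\<close>
    tends to 1 afterwards.\<close>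
  have part: "ennreal (z * K) \<le> X" if z: "0 < z" "z < 1" for z
  proof -
    define c d where "c = (1 - z) / 2" and "d = (1 + z) / 2"
    have cd: "0 < c" "c < d" "d < 1" "d - c = z" using z by (auto simp: c_def d_def field_simps)
    then have sub: "{c..d} \<subseteq> {0<..<1}" by auto
    have c\<rho>: "continuous_on {c..d} \<rho>" "continuous_on {c..d} \<sigma>"
      using \<rho>(2) \<sigma>(2) sub by (meson DERIV_continuous continuous_at_imp_continuous_on subsetD)+
    have cg\<rho>: "continuous_on {c..d} (\<lambda>u. g (\<rho> u))"
      by (rule continuous_on_compose2[OF g(1) c\<rho>(1)]) (use \<rho>(1) sub in force)
    have ch\<sigma>: "continuous_on {c..d} (\<lambda>u. h (\<sigma> u))"
      by (rule continuous_on_compose2[OF h(1) c\<rho>(2)]) (use \<sigma>(1) sub in force)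
    have "\<rho> u + \<sigma> u \<noteq> 0" "g (\<rho> u) * \<rho> u ^ (n-1) \<noteq> 0" "h (\<sigma> u) * \<sigma> u ^ (n-1) \<noteq> 0" if "u \<in> {c..d}" for u
      using pos[of u] that sub by auto
    then have c\<tau>': "continuous_on {c..d} \<tau>'"
      unfolding \<tau>'_def by (intro continuous_intros c\<rho> cg\<rho> ch\<sigma>) auto
    have meas: "set_borel_measurable borel {\<tau> c..\<tau> d} (\<lambda>t. m t * t ^ (n - 1))"
    proof -
      have "(\<lambda>t. (indicator {0..} t *\<^sub>R m t) * (t ^ (n - 1) * indicator {\<tau> c..\<tau> d} t)) \<in> borel_measurable borel"
        using m(2) unfolding set_borel_measurable_def by measurable
      also have "(\<lambda>t. (indicator {0..} t *\<^sub>R m t) * (t ^ (n - 1) * indicator {\<tau> c..\<tau> d} t)) =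
        (\<lambda>t. indicator {\<tau> c..\<tau> d} t *\<^sub>R (m t * t ^ (n - 1)))"
        using \<tau>0[of c] cd by (auto simp: indicator_def fun_eq_iff)
      finally show ?thesis unfolding set_borel_measurable_def .
    qed
    have "ennreal (z * K) = (\<integral>\<^sup>+u. ennreal K * indicator {c..d} u \<partial>lborel)"
      using cd K0 by (simp add: nn_integral_cmult_indicator ennreal_mult' mult.commute flip: \<open>d - c = z\<close>)
    also have "\<dots> \<le> (\<integral>\<^sup>+u. ennreal (m (\<tau> u) * \<tau> u ^ (n - 1) * \<tau>' u * indicator {c..d} u) \<partial>lborel)"
      using key sub by (intro nn_integral_mono) (auto simp: indicator_def intro!: ennreal_leI)
    also have "\<dots> = (\<integral>\<^sup>+t. ennreal (m t * t ^ (n - 1) * indicator {\<tau> c..\<tau> d} t) \<partial>lborel)"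
      by (rule nn_integral_substitution[where g=\<tau> and a=c and b=d, OF meas, symmetric])
        (use d\<tau> \<tau>'0 sub cd c\<tau>' in auto)
    also have "\<dots> \<le> X" unfolding X_def
      using \<tau>0[of c] cd by (intro nn_integral_mono) (auto simp: indicator_def)
    finally show ?thesis .
  qed
  have "ennreal K \<le> X"
  proof (cases "X = \<infinity>")
    case False
    then obtain x where x: "X = ennreal x" "x \<ge> 0" by (cases X) auto
    have "K \<le> x" by (rule field_le_mult_one_interval) (use part x in auto)
    then show ?thesis using x by (simp add: ennreal_leI)
  qed auto
  then show "ennreal ((A powr (- 1 / n) + B powr (- 1 / n)) powr (- real n))
      \<le> (\<integral>\<^sup>+t\<in>{0..}. ennreal (m t * t ^ (n - 1)) \<partial>lborel)" by (simp add: K_def X_def)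
qed

text \<open>Models the functions r -> f(r x) on the half-line. Monotonicity yields measurability,
  log-concavity yields continuity inside the support, and a positive value away from 0 keeps the
  radial integral positive.\<close>

definition ray_profile :: "(real \<Rightarrow> real) \<Rightarrow> bool" where
  "ray_profile g \<longleftrightarrow> (\<forall>r. 0 \<le> g r) \<and> antimono_on {0..} g \<and> (\<exists>\<delta>>0. g \<delta> > 0) \<and>
     (\<forall>r\<ge>0. \<forall>s\<ge>0. \<forall>t. 0 < t \<and> t < 1 \<longrightarrow>
        g r powr (1 - t) * g s powr t \<le> g ((1 - t) * r + t * s))"

lemma ray_profile_nonneg: "ray_profile g \<Longrightarrow> 0 \<le> g r"
  and ray_profile_antimono: "ray_profile g \<Longrightarrow> 0 \<le> r \<Longrightarrow> r \<le> s \<Longrightarrow> g s \<le> g r"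
  by (auto simp: ray_profile_def monotone_on_def)

lemma ray_profile_measurable:
  assumes "ray_profile g"
  shows "set_borel_measurable borel {0..} g"
proof -
  have "mono (\<lambda>r. - g (max 0 r))"
    using ray_profile_antimono[OF assms] by (auto intro!: monoI)
  then have "(\<lambda>r. - g (max 0 r)) \<in> borel_measurable borel" by (rule borel_measurable_mono)
  then have "(\<lambda>r. indicator {0..} r *\<^sub>R (- (- g (max 0 r)))) \<in> borel_measurable borel"
    by measurable
  also have "(\<lambda>r. indicator {0..} r *\<^sub>R (- (- g (max 0 r)))) = (\<lambda>r. indicator {0..} r *\<^sub>R g r)"
    by (auto simp: indicator_def fun_eq_iff)
  finally show ?thesis unfolding set_borel_measurable_def .
qed

text \<open>A concave function may drop at an endpoint, so continuity at 0 is not automatic.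
  Reflection makes 0 an interior point, and r -> -ln g(|r|) is still convex because \<open>g\<close>
  decreases.\<close>

lemma ray_profile_continuous_on:
  assumes g: "ray_profile g" and b: "0 \<le> a" "a < b" "g b > 0"
  shows "continuous_on {0..a} g"
proof -
  have pos: "g \<bar>r\<bar> > 0" if "r \<in> {-b<..<b}" for r
    using ray_profile_antimono[OF g, of "\<bar>r\<bar>" b] b that by force
  have "convex_on {-b<..<b} (\<lambda>r. - ln (g \<bar>r\<bar>))"
  proof (rule convex_onI)
    fix t x y :: real assume t: "0 < t" "t < 1" and xy: "x \<in> {-b<..<b}" "y \<in> {-b<..<b}"
    have c: "(1 - t) * x + t * y \<in> {-b<..<b}"
      using convexD_alt[of "{-b<..<b}" x y t] xy t by simp
    have "g \<bar>x\<bar> powr (1 - t) * g \<bar>y\<bar> powr t \<le> g ((1 - t) * \<bar>x\<bar> + t * \<bar>y\<bar>)"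
      using g t by (auto simp: ray_profile_def)
    also have "\<dots> \<le> g \<bar>(1 - t) * x + t * y\<bar>"
    proof (rule ray_profile_antimono[OF g])
      have "\<bar>(1 - t) * x + t * y\<bar> \<le> \<bar>(1 - t) * x\<bar> + \<bar>t * y\<bar>" by (rule abs_triangle_ineq)
      then show "\<bar>(1 - t) * x + t * y\<bar> \<le> (1 - t) * \<bar>x\<bar> + t * \<bar>y\<bar>" using t by (simp add: abs_mult)
    qed auto
    finally have "ln (g \<bar>x\<bar> powr (1 - t) * g \<bar>y\<bar> powr t) \<le> ln (g \<bar>(1 - t) * x + t * y\<bar>)"
      using pos[OF xy(1)] pos[OF xy(2)] pos[OF c] by (subst ln_le_cancel_iff) auto
    then show "- ln (g \<bar>(1 - t) *\<^sub>R x + t *\<^sub>R y\<bar>) \<le> (1 - t) * - ln (g \<bar>x\<bar>) + t * - ln (g \<bar>y\<bar>)"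
      using pos[OF xy(1)] pos[OF xy(2)] by (simp add: ln_mult ln_powr)
  qed auto
  then have "continuous_on {-b<..<b} (\<lambda>r. - ln (g \<bar>r\<bar>))"
    by (intro convex_on_continuous) auto
  then have "continuous_on {0..a} (\<lambda>r. - ln (g \<bar>r\<bar>))"
    by (rule continuous_on_subset) (use b in auto)
  then have "continuous_on {0..a} (\<lambda>r. exp (- (- ln (g \<bar>r\<bar>))))"
    by (rule continuous_on_exp[OF continuous_on_minus])
  then show ?thesis
  proof (rule continuous_on_eq)
    fix r assume "r \<in> {0..a}"
    then show "exp (- (- ln (g \<bar>r\<bar>))) = g r" using pos[of r] b by simp
  qed
qed

text \<open>The positivity set is an interval starting at 0; the \<open>a k\<close> increase to its
  supremum while staying strictly below it, as \<open>ray_profile_continuous_on\<close> requires.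
  Only the supremum itself, here \<open>R\<close>, can be missed, and one point is a null
  set.\<close>

lemma ray_profile_exhaustion:
  assumes g: "ray_profile g"
  obtains a :: "nat \<Rightarrow> real" and R where "incseq a" "\<And>k. a k > 0" "\<And>k. \<exists>b>a k. g b > 0"
    "\<And>r. 0 \<le> r \<Longrightarrow> g r > 0 \<Longrightarrow> r \<noteq> R \<Longrightarrow> \<exists>k. r \<le> a k"
proof -
  define S where "S = {r. 0 \<le> r \<and> g r > 0}"
  obtain \<delta> where \<delta>: "\<delta> > 0" "\<delta> \<in> S" using g by (auto simp: ray_profile_def S_def)
  show ?thesis
  proof (cases "bdd_above S")
    case True
    define R where "R = Sup S"
    have ub: "r \<le> R" if "r \<in> S" for r unfolding R_def using cSup_upper[OF that True] .
    then have R: "R > 0" using \<delta> by force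
    \<comment> \<open>The shift by 2 makes already \<open>a 0\<close> = R/2 positive.\<close>
    define a where "a = (\<lambda>k. R * (1 - 1 / (real k + 2)))"
    show ?thesis
    proof (rule that[of a R])
      show "incseq a" unfolding a_def using R
        by (intro incseq_SucI mult_left_mono) (auto intro!: divide_left_mono)
      show "a k > 0" for k unfolding a_def by (rule mult_pos_pos[OF R]) simp
      show "\<exists>b>a k. g b > 0" for k
      proof -
        have "a k < Sup S" unfolding a_def R_def[symmetric] using R by (simp add: field_simps)
        then obtain b where "b \<in> S" "a k < b" using less_cSup_iff[of S "a k"] \<delta> True by blast
        then show ?thesis by (auto simp: S_def)
      qed
      show "\<exists>k. r \<le> a k" if "0 \<le> r" "g r > 0" "r \<noteq> R" for r
      proof -
        have "r < R" using ub[of r] that by (auto simp: S_def)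
        then have "0 < 1 - r / R" using R by auto
        then obtain k where "1 / real (Suc k) < 1 - r / R" using nat_approx_posE by blast
        moreover have "1 / (real k + 2) \<le> 1 / real (Suc k)" by (intro divide_left_mono) auto
        ultimately have "r / R \<le> 1 - 1 / (real k + 2)" by linarith
        then have "r \<le> a k" unfolding a_def using R by (simp add: pos_divide_le_eq mult.commute)
        then show ?thesis ..
      qed
    qed
  next
    case False
    \<comment> \<open>The \<open>a k\<close> exhaust the whole half-line, so \<open>R\<close> = 0 is
      a placeholder.\<close>
    show ?thesis
    proof (rule that[of "\<lambda>k. real (Suc k)" 0])
      show "\<exists>b>real (Suc k). g b > 0" for k
      proof -
        obtain b where "b \<in> S" "\<not> b \<le> real (Suc k)" using False unfolding bdd_above_def by blast
        then show ?thesis by (intro exI[of _ b]) (auto simp: S_def)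
      qed
      show "\<exists>k. r \<le> real (Suc k)" for r
        using real_nat_ceiling_ge[of r] by (intro exI[of _ "nat \<lceil>r\<rceil>"]) simp
    qed (auto intro!: incseq_SucI)
  qed
qed

section \<open>Radial integrals and the general form of Ball's inequality\<close>

definition ray_integral :: "nat \<Rightarrow> (real \<Rightarrow> real) \<Rightarrow> ennreal" where
  "ray_integral n g = (\<integral>\<^sup>+r\<in>{0..}. ennreal (g r * r ^ (n - 1)) \<partial>lborel)"

lemma ray_integral_measurable:
  assumes "set_borel_measurable borel {0..} g"
  shows "(\<lambda>r. ennreal (g r * r ^ (n - 1)) * indicator {0..} r) \<in> borel_measurable borel"
proof -
  have "(\<lambda>r. ennreal ((indicator {0..} r *\<^sub>R g r) * r ^ (n - 1)) * indicator {0..} r) \<in> borel_measurable borel"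
    using assms unfolding set_borel_measurable_def by measurable
  also have "(\<lambda>r. ennreal ((indicator {0..} r *\<^sub>R g r) * r ^ (n - 1)) * indicator {0..} r) =
     (\<lambda>r. ennreal (g r * r ^ (n - 1)) * indicator {0..} r)"
    by (auto simp: indicator_def fun_eq_iff)
  finally show ?thesis .
qed

text \<open>Monotone convergence along the intervals of \<open>ray_profile_exhaustion\<close>. It
  expresses the extended-valued radial integral by ordinary integrals over compact intervals, on
  which the transport works.\<close>

lemma ray_integral_limit:
  assumes g: "ray_profile g" and fin: "ray_integral n g \<noteq> \<infinity>"
  obtains a where "\<And>k. a k > 0" "\<And>k. continuous_on {0..a k} g"
    "\<And>k r. 0 \<le> r \<Longrightarrow> r \<le> a k \<Longrightarrow> g r > 0"
    "(\<lambda>k::nat. integral {0..a k} (\<lambda>r. g r * r ^ (n - 1))) \<longlonglongrightarrow> enn2real (ray_integral n g)"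
    "\<And>k. integral {0..a k} (\<lambda>r. g r * r ^ (n - 1)) \<le> enn2real (ray_integral n g)"
proof -
  obtain a R where a: "incseq a" "\<And>k. a k > 0" "\<And>k. \<exists>b>a k. g b > 0"
    "\<And>r. 0 \<le> r \<Longrightarrow> g r > 0 \<Longrightarrow> r \<noteq> R \<Longrightarrow> \<exists>k::nat. r \<le> a k"
    using ray_profile_exhaustion[OF g] by blast
  have cont: "continuous_on {0..a k} g" for k
    using a(3)[of k] ray_profile_continuous_on[OF g] a(2)[of k] by (meson less_imp_le)
  have pos: "g r > 0" if "0 \<le> r" "r \<le> a k" for r k
    using a(3)[of k] ray_profile_antimono[OF g, of r] that by (meson less_le_trans order.trans less_imp_le)
  define F where "F = (\<lambda>k r. ennreal (g r * r ^ (n - 1)) * indicator {0..a k} r)"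
  define I where "I = (\<lambda>k. integral {0..a k} (\<lambda>r. g r * r ^ (n - 1)))"
  have FI: "(\<integral>\<^sup>+r. F k r \<partial>lborel) = ennreal (I k)" for k
    unfolding F_def I_def
    by (rule nn_integral_has_integral_lebesgue')
      (auto intro!: integrable_integral integrable_continuous_interval continuous_intros cont
         mult_nonneg_nonneg ray_profile_nonneg[OF g])
  have I0: "I k \<ge> 0" for k unfolding I_def
    by (rule integral_nonneg)
      (auto intro!: integrable_continuous_interval continuous_intros cont mult_nonneg_nonneg ray_profile_nonneg[OF g])
  have Fmeas: "F k \<in> borel_measurable lborel" for k
  proof -
    have "(\<lambda>r. (ennreal (g r * r ^ (n - 1)) * indicator {0..} r) * indicator {0..a k} r) \<in> borel_measurable borel"
      using ray_integral_measurable[OF ray_profile_measurable[OF g]] by measurable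
    also have "(\<lambda>r. (ennreal (g r * r ^ (n - 1)) * indicator {0..} r) * indicator {0..a k} r) = F k"
      by (auto simp: F_def indicator_def fun_eq_iff)
    finally show ?thesis by simp
  qed
  have incF: "incseq F"
  proof (rule incseq_SucI, rule le_funI)
    fix k r
    have "a k \<le> a (Suc k)" using a(1) by (simp add: incseq_SucD)
    then show "F k r \<le> F (Suc k) r" by (auto simp: F_def indicator_def)
  qed
  have sup: "(SUP k. F k r) = ennreal (g r * r ^ (n - 1)) * indicator {0..} r" if neq: "r \<noteq> R" for r
  proof (cases "0 \<le> r \<and> g r > 0")
    case True
    then obtain k where k: "r \<le> a k" using a(4)[of r] neq by blast
    show ?thesis
    proof (rule antisym)
      show "(SUP k. F k r) \<le> ennreal (g r * r ^ (n - 1)) * indicator {0..} r"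
        by (rule SUP_least) (auto simp: F_def indicator_def)
      show "ennreal (g r * r ^ (n - 1)) * indicator {0..} r \<le> (SUP k. F k r)"
        using k True by (intro SUP_upper2[of k]) (auto simp: F_def indicator_def)
    qed
  next
    case False
    then have "g r = 0 \<or> r < 0" using ray_profile_nonneg[OF g, of r] by force
    then show ?thesis by (auto simp: F_def indicator_def)
  qed
  have "ray_integral n g = (\<integral>\<^sup>+r. (SUP k. F k r) \<partial>lborel)"
    unfolding ray_integral_def
  proof (rule nn_integral_cong_AE)
    show "AE r in lborel. ennreal (g r * r ^ (n - 1)) * indicator {0..} r = (SUP k. F k r)"
      using AE_lborel_singleton[of R] by (auto simp: sup)
  qed
  also have "\<dots> = (SUP k. ennreal (I k))"
    using nn_integral_monotone_convergence_SUP[OF incF Fmeas] by (simp add: FI)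
  finally have eq: "ray_integral n g = (SUP k. ennreal (I k))" .
  have incI: "incseq (\<lambda>k. ennreal (I k))"
    unfolding FI[symmetric] using incF by (auto simp: incseq_def le_fun_def intro!: nn_integral_mono)
  have lim: "(\<lambda>k. ennreal (I k)) \<longlonglongrightarrow> ennreal (enn2real (ray_integral n g))"
  proof -
    have "ennreal (enn2real (ray_integral n g)) = ray_integral n g"
      using fin by (simp add: less_top)
    then show ?thesis using LIMSEQ_SUP[OF incI] by (simp only: eq)
  qed
  show ?thesis
  proof (rule that[OF a(2) cont pos])
    show "(\<lambda>k. integral {0..a k} (\<lambda>r. g r * r ^ (n - 1))) \<longlonglongrightarrow> enn2real (ray_integral n g)"
      using lim I0 by (simp add: I_def tendsto_ennreal_iff)
    show "integral {0..a k} (\<lambda>r. g r * r ^ (n - 1)) \<le> enn2real (ray_integral n g)" for k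
    proof -
      have "ennreal (I k) \<le> ray_integral n g" unfolding eq by (rule SUP_upper) simp
      from enn2real_mono[OF this] have "enn2real (ennreal (I k)) \<le> enn2real (ray_integral n g)"
        using fin by (simp add: less_top)
      then show ?thesis using I0[of k] by (simp add: I_def)
    qed
  qed auto
qed

text \<open>The compact case compares the truncated integrals of \<open>g\<close> and
  \<open>h\<close> at once with the full integral of \<open>m\<close>, so only \<open>A k\<close>
  and \<open>B k\<close> have to tend to their limits.\<close>

lemma Ball_inequality:
  assumes n: "n \<ge> 1" and g: "ray_profile g" and h: "ray_profile h"
    and m: "\<And>r. m r \<ge> 0" "set_borel_measurable borel {0..} m"
    and ghm: "\<And>r s. r > 0 \<Longrightarrow> s > 0 \<Longrightarrow>
      g r powr (s / (r + s)) * h s powr (r / (r + s)) \<le> m (r * s / (r + s))"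
    and fin: "ray_integral n g \<noteq> \<infinity>" "ray_integral n h \<noteq> \<infinity>" "ray_integral n m \<noteq> \<infinity>"
  shows "(n * enn2real (ray_integral n m)) powr (- 1 / n) \<le>
    (n * enn2real (ray_integral n g)) powr (- 1 / n) + (n * enn2real (ray_integral n h)) powr (- 1 / n)"
proof -
  obtain a where a: "\<And>k. a k > 0" "\<And>k. continuous_on {0..a k} g"
    "\<And>k r. 0 \<le> r \<Longrightarrow> r \<le> a k \<Longrightarrow> g r > 0"
    "(\<lambda>k::nat. integral {0..a k} (\<lambda>r. g r * r ^ (n - 1))) \<longlonglongrightarrow> enn2real (ray_integral n g)"
    "\<And>k. integral {0..a k} (\<lambda>r. g r * r ^ (n - 1)) \<le> enn2real (ray_integral n g)"
    using ray_integral_limit[OF g fin(1)] by blast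
  obtain b where b: "\<And>k. b k > 0" "\<And>k. continuous_on {0..b k} h"
    "\<And>k r. 0 \<le> r \<Longrightarrow> r \<le> b k \<Longrightarrow> h r > 0"
    "(\<lambda>k::nat. integral {0..b k} (\<lambda>r. h r * r ^ (n - 1))) \<longlonglongrightarrow> enn2real (ray_integral n h)"
    "\<And>k. integral {0..b k} (\<lambda>r. h r * r ^ (n - 1)) \<le> enn2real (ray_integral n h)"
    using ray_integral_limit[OF h fin(2)] by blast
  define A where "A = (\<lambda>k. integral {0..a k} (\<lambda>r. g r * r ^ (n - 1)))"
  define B where "B = (\<lambda>k. integral {0..b k} (\<lambda>r. h r * r ^ (n - 1)))"
  define A' B' M where "A' = enn2real (ray_integral n g)" and "B' = enn2real (ray_integral n h)"
    and "M = enn2real (ray_integral n m)"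
  have A: "A k > 0" and B: "B k > 0" for k
    using Ball_inequality_compact(1,2)[OF n a(1)[of k] b(1)[of k] a(2) a(3)[where k=k] b(2) b(3)[where k=k] m ghm]
    by (auto simp: A_def B_def)
  have A': "A' > 0" and B': "B' > 0"
    using A[of 0] a(5)[of 0] B[of 0] b(5)[of 0] by (auto simp: A_def B_def A'_def B'_def)
  have M: "(A k powr (- 1 / n) + B k powr (- 1 / n)) powr (- real n) \<le> M" for k
  proof -
    have "ennreal ((A k powr (- 1 / n) + B k powr (- 1 / n)) powr (- real n)) \<le> ray_integral n m"
      using Ball_inequality_compact(3)[OF n a(1)[of k] b(1)[of k] a(2) a(3)[where k=k] b(2) b(3)[where k=k] m ghm]
      by (simp add: A_def B_def ray_integral_def)
    from enn2real_mono[OF this] show ?thesis using fin(3) by (simp add: M_def top.not_eq_extremum)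
  qed
  define S where "S = A' powr (- 1 / n) + B' powr (- 1 / n)"
  have S: "S > 0" using A' B' by (auto simp: S_def intro!: add_pos_pos)
  have "(\<lambda>k. (A k powr (- 1 / n) + B k powr (- 1 / n)) powr (- real n)) \<longlonglongrightarrow> S powr (- real n)"
    unfolding S_def using a(4) b(4) A' B' S
    by (intro tendsto_intros) (auto simp: A_def B_def A'_def B'_def S_def)
  then have le: "S powr (- real n) \<le> M"
    by (rule LIMSEQ_le_const2) (use M in auto)
  have "M powr (- 1 / n) \<le> (S powr (- real n)) powr (- 1 / n)"
    using le S by (intro powr_mono2') auto
  also have "\<dots> = S" using S n by (simp add: powr_powr)
  finally have "M powr (- 1 / n) \<le> S" .
  \<comment> \<open>The factor n is the normalisation of the gauge; by homogeneity it multiplies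
    both sides by the same power.\<close>
  then have "real n powr (- 1 / n) * M powr (- 1 / n) \<le> real n powr (- 1 / n) * S"
    by (intro mult_left_mono) auto
  then show ?thesis
    using A' B' by (simp add: powr_mult M_def A'_def B'_def S_def distrib_left)
qed

text \<open>Cutting off at 1 multiplies by the indicator of an interval, which preserves
  log-concavity: if one factor on the left is cut off, the product is 0.\<close>

lemma ray_profile_truncate:
  assumes g: "ray_profile g"
  shows "ray_profile (\<lambda>r. if r \<le> 1 then g r else 0)"
  unfolding ray_profile_def
proof (intro conjI allI impI; (elim conjE)?)
  show "0 \<le> (if r \<le> 1 then g r else 0)" for r using ray_profile_nonneg[OF g] by simp
  show "antimono_on {0..} (\<lambda>r. if r \<le> 1 then g r else 0)"
    using ray_profile_antimono[OF g] ray_profile_nonneg[OF g] by (auto simp: monotone_on_def)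
  obtain \<delta> where \<delta>: "\<delta> > 0" "g \<delta> > 0" using g by (auto simp: ray_profile_def)
  have "g (min \<delta> 1) > 0" using ray_profile_antimono[OF g, of "min \<delta> 1" \<delta>] \<delta> by simp
  then show "\<exists>\<delta>>0. 0 < (if \<delta> \<le> 1 then g \<delta> else 0)"
    using \<delta> by (intro exI[of _ "min \<delta> 1"]) auto
  fix r s t :: real assume rs: "0 \<le> r" "0 \<le> s" and t: "0 < t" "t < 1"
  show "(if r \<le> 1 then g r else 0) powr (1 - t) * (if s \<le> 1 then g s else 0) powr t
      \<le> (if (1 - t) * r + t * s \<le> 1 then g ((1 - t) * r + t * s) else 0)"
  proof (cases "r \<le> 1 \<and> s \<le> 1")
    case True
    have "(1 - t) * r + t * s \<le> 1"
      using True t convex_bound_le[of r 1 s "1 - t" t] by auto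
    moreover have "g r powr (1 - t) * g s powr t \<le> g ((1 - t) * r + t * s)"
      using g rs t unfolding ray_profile_def by blast
    ultimately show ?thesis using True by simp
  next
    case False
    then show ?thesis using ray_profile_nonneg[OF g] by auto
  qed
qed

section \<open>Scaling and two explicit radial integrals\<close>

lemma ray_integral_scale:
  assumes c: "c > 0" and n: "n \<ge> 1" and g: "set_borel_measurable borel {0..} g"
  shows "ray_integral n g = ennreal (c ^ n) * ray_integral n (\<lambda>r. g (c * r))"
proof -
  have pow: "c ^ n = c * c ^ (n - 1)" using n by (metis One_nat_def Suc_pred less_eq_Suc_le power_Suc)
  have g': "set_borel_measurable borel {0..} (\<lambda>r. g (c * r))"
  proof -
    have "(\<lambda>r. indicator {0..} (c * r) *\<^sub>R g (c * r)) \<in> borel_measurable borel"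
      using measurable_compose[OF _ g[unfolded set_borel_measurable_def], of "\<lambda>r. c * r" borel] by simp
    also have "(\<lambda>r. indicator {0..} (c * r) *\<^sub>R g (c * r)) = (\<lambda>r. indicator {0..} r *\<^sub>R g (c * r))"
      using c by (auto simp: indicator_def fun_eq_iff zero_le_mult_iff)
    finally show ?thesis unfolding set_borel_measurable_def .
  qed
  have "ray_integral n g = ennreal \<bar>c\<bar> *
      (\<integral>\<^sup>+r. ennreal (g (0 + c * r) * (0 + c * r) ^ (n - 1)) * indicator {0..} (0 + c * r) \<partial>lborel)"
    unfolding ray_integral_def
    by (rule nn_integral_real_affine[OF ray_integral_measurable[OF g]]) (use c in auto)
  also have "\<dots> = ennreal c *
      (\<integral>\<^sup>+r. ennreal (c ^ (n - 1)) * (ennreal (g (c * r) * r ^ (n - 1)) * indicator {0..} r) \<partial>lborel)"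
    using c
    by (auto intro!: arg_cong2[where f="(*)"] nn_integral_cong
      simp: indicator_def zero_le_mult_iff power_mult_distrib ac_simps simp flip: ennreal_mult')
  also have "\<dots> = ennreal c * (ennreal (c ^ (n - 1)) * ray_integral n (\<lambda>r. g (c * r)))"
    unfolding ray_integral_def using ray_integral_measurable[OF g']
    by (subst nn_integral_cmult) auto
  also have "\<dots> = ennreal (c ^ n) * ray_integral n (\<lambda>r. g (c * r))"
    using c by (simp add: pow ennreal_mult mult.assoc)
  finally show ?thesis .
qed

lemma nn_integral_power_unit_interval:
  assumes "n \<ge> 1" "c \<ge> 0"
  shows "(\<integral>\<^sup>+r\<in>{0..1}. ennreal (c * r ^ (n - 1)) \<partial>lborel) = ennreal (c / n)"
proof (rule nn_integral_has_integral_lebesgue')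
  have "((\<lambda>r. c * r ^ (n - 1)) has_integral c * 1 ^ n / n - c * 0 ^ n / n) {0..1}"
  proof (rule fundamental_theorem_of_calculus)
    fix r :: real
    have "((\<lambda>r. c * r ^ n / n) has_real_derivative c * r ^ (n - 1)) (at r within {0..1})"
      using assms by (auto intro!: derivative_eq_intros)
    then show "((\<lambda>r. c * r ^ n / n) has_vector_derivative c * r ^ (n - 1)) (at r within {0..1})"
      by (simp add: has_real_derivative_iff_has_vector_derivative)
  qed auto
  then show "((\<lambda>r. c * r ^ (n - 1)) has_integral c / n) {0..1}" using assms by (simp add: power_0_left)
qed (use assms in auto)

lemma nn_integral_exp_power_finite:
  assumes a: "a > 0" and b: "b \<ge> 0"
  obtains Q where "Q > 0" "(\<integral>\<^sup>+r\<in>{0..}. ennreal (b * exp (- (a * r)) * r ^ (n - 1)) \<partial>lborel) \<le> ennreal Q"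
proof -
  \<comment> \<open>Half of the decay rate absorbs the polynomial: k y = a/2 and n - 1 \<le> k give
    (y r)^(n-1) \<le> exp(a r/2).\<close>
  define k where "k = real n + 1"
  define y where "y = a / (2 * k)"
  have k: "k > 0" and y: "y > 0" using a by (auto simp: k_def y_def)
  have pw: "r ^ (n - 1) \<le> exp (a / 2 * r) / y ^ (n - 1)" if "r \<ge> 0" for r
  proof -
    have "(y * r) ^ (n - 1) \<le> exp (y * r) ^ (n - 1)"
    proof (rule power_mono)
      show "y * r \<le> exp (y * r)" using exp_ge_add_one_self[of "y * r"] by linarith
    qed (use y that in simp)
    also have "\<dots> = exp (real (n - 1) * (y * r))" by (simp add: exp_of_nat_mult)
    also have "\<dots> \<le> exp (k * (y * r))"
      using y that by (auto intro!: mult_right_mono simp: k_def)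
    also have "k * (y * r) = a / 2 * r" using k by (simp add: y_def)
    finally show ?thesis using y by (simp add: power_mult_distrib pos_le_divide_eq mult.commute)
  qed
  \<comment> \<open>The summand 1 keeps \<open>Q\<close> positive when \<open>b\<close> = 0.\<close>
  define Q where "Q = b / y ^ (n - 1) * (exp (- (a / 2) * 0) / (a / 2)) + 1"
  have "((\<lambda>r. b / y ^ (n - 1) * exp (- (a / 2) * r)) has_integral b / y ^ (n - 1) * (exp (- (a / 2) * 0) / (a / 2))) {0..}"
    by (rule has_integral_mult_right) (rule has_integral_exp_minus_to_infinity, use a in simp)
  then have I: "(\<integral>\<^sup>+r\<in>{0..}. ennreal (b / y ^ (n - 1) * exp (- (a / 2) * r)) \<partial>lborel)
      = ennreal (b / y ^ (n - 1) * (exp (- (a / 2) * 0) / (a / 2)))"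
    by (intro nn_integral_has_integral_lebesgue') (use b y in auto)
  have "(\<integral>\<^sup>+r\<in>{0..}. ennreal (b * exp (- (a * r)) * r ^ (n - 1)) \<partial>lborel) \<le>
      (\<integral>\<^sup>+r\<in>{0..}. ennreal (b / y ^ (n - 1) * exp (- (a / 2) * r)) \<partial>lborel)"
  proof (rule nn_integral_mono)
    fix r :: real
    show "ennreal (b * exp (- (a * r)) * r ^ (n - 1)) * indicator {0..} r \<le>
      ennreal (b / y ^ (n - 1) * exp (- (a / 2) * r)) * indicator {0..} r"
    proof (cases "r \<ge> 0")
      case True
      have "b * exp (- (a * r)) * r ^ (n - 1) \<le> b * exp (- (a * r)) * (exp (a / 2 * r) / y ^ (n - 1))"
        using pw[OF True] b by (intro mult_left_mono) auto
      also have "\<dots> = b / y ^ (n - 1) * (exp (- (a * r)) * exp (a / 2 * r))" by simp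
      also have "exp (- (a * r)) * exp (a / 2 * r) = exp (- (a / 2) * r)"
        by (simp flip: exp_add)
      finally show ?thesis using True by (simp add: ennreal_leI)
    qed auto
  qed
  also have "\<dots> \<le> ennreal Q" unfolding I Q_def by (intro ennreal_leI) simp
  finally show ?thesis using b y a by (intro that[of Q]) (auto simp: Q_def add_nonneg_pos)
qed

section \<open>Even log-concave densities\<close>

lemmas vec_defs = vzero_def vscale_def vadd_def vdiff_def vneg_def

lemma Rn_closed [simp]:
  "vzero \<in> Rn n"
  "x \<in> Rn n \<Longrightarrow> vscale r x \<in> Rn n"
  "x \<in> Rn n \<Longrightarrow> y \<in> Rn n \<Longrightarrow> vadd x y \<in> Rn n"
  "x \<in> Rn n \<Longrightarrow> y \<in> Rn n \<Longrightarrow> vdiff x y \<in> Rn n"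
  "x \<in> Rn n \<Longrightarrow> vneg x \<in> Rn n"
  by (auto simp: Rn_def vec_defs)

text \<open>Points of the product measure space are \<open>undefined\<close> outside
  \<open>{..<n}\<close>, points of \<open>Rn n\<close> vanish there; \<open>lebesgue_n\<close> is
  pushed forward along this map between them.\<close>

definition zero_extend :: "nat \<Rightarrow> (nat \<Rightarrow> real) \<Rightarrow> (nat \<Rightarrow> real)" where
  "zero_extend n x = (\<lambda>i. if i < n then x i else 0)"

definition unit_vec :: "nat \<Rightarrow> nat \<Rightarrow> real" where
  "unit_vec i = (\<lambda>j. if j = i then 1 else 0)"

lemma zero_extend_Rn [simp]: "zero_extend n x \<in> Rn n"
  by (auto simp: zero_extend_def Rn_def)

lemma unit_vec_Rn [simp]: "i < n \<Longrightarrow> unit_vec i \<in> Rn n"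
  by (auto simp: unit_vec_def Rn_def)

lemma zero_extend_measurable [measurable]:
  "zero_extend n \<in> (\<Pi>\<^sub>M i\<in>{..<n}. lborel) \<rightarrow>\<^sub>M (\<Pi>\<^sub>M i\<in>UNIV. borel)"
  unfolding zero_extend_def
proof (rule measurable_PiM_single')
  fix i :: nat
  show "(\<lambda>x. if i < n then x i else 0) \<in> borel_measurable (\<Pi>\<^sub>M i\<in>{..<n}. lborel)"
  proof (cases "i < n")
    case True
    then have "(\<lambda>x. x i) \<in> (\<Pi>\<^sub>M i\<in>{..<n}. lborel) \<rightarrow>\<^sub>M (lborel :: real measure)"
      by (intro measurable_component_singleton) auto
    then show ?thesis using True by simp
  qed auto
qed auto

interpretation lborel_product: product_sigma_finite "\<lambda>_::nat. lborel :: real measure"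
  by standard

text \<open>The integral is a supremum over simple functions below the integrand, and completing the
  measure does not change it, even if \<open>F\<close> is not measurable.\<close>

lemma nn_integral_lebesgue_n:
  "(\<integral>\<^sup>+x. F x \<partial>lebesgue_n n) =
   (\<integral>\<^sup>+x. F x \<partial>distr (\<Pi>\<^sub>M i\<in>{..<n}. lborel) (\<Pi>\<^sub>M i\<in>UNIV. borel) (zero_extend n))"
  unfolding lebesgue_n_def nn_integral_completion zero_extend_def ..

text \<open>Fubini in the coordinate \<open>i\<close>: each line in that direction meets
  \<open>E\<close> in a null set.\<close>

lemma emeasure_PiM_at_most_one_per_line:
  fixes n i :: nat
  assumes E: "E \<in> sets (\<Pi>\<^sub>M i\<in>{..<n}. (lborel :: real measure))" and i: "i < n"
    and one: "\<And>x y z. x(i := y) \<in> E \<Longrightarrow> x(i := z) \<in> E \<Longrightarrow> y = z"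
  shows "emeasure (\<Pi>\<^sub>M i\<in>{..<n}. (lborel :: real measure)) E = 0"
proof -
  let ?I = "{..<n} - {i}"
  have I: "insert i ?I = {..<n}" using i by auto
  have line: "(\<integral>\<^sup>+y. indicator E (x(i := y)) \<partial>(lborel :: real measure)) = 0" for x
  proof -
    obtain z where z: "\<And>y. x(i := y) \<in> E \<Longrightarrow> y = z" using one by blast
    have "(\<integral>\<^sup>+y. indicator E (x(i := y)) \<partial>(lborel :: real measure)) \<le> (\<integral>\<^sup>+y. indicator {z} y \<partial>lborel)"
      by (intro nn_integral_mono) (auto simp: indicator_def dest: z)
    then show ?thesis by simp
  qed
  have "emeasure (\<Pi>\<^sub>M i\<in>{..<n}. (lborel :: real measure)) E =
      (\<integral>\<^sup>+x. indicator E x \<partial>(\<Pi>\<^sub>M i\<in>insert i ?I. lborel))"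
    using E by (simp only: I nn_integral_indicator)
  also have "\<dots> = (\<integral>\<^sup>+x. (\<integral>\<^sup>+y. indicator E (x(i := y)) \<partial>lborel) \<partial>(\<Pi>\<^sub>M i\<in>?I. lborel))"
    using E I by (intro lborel_product.product_nn_integral_insert[of ?I i "indicator E"]) auto
  also have "\<dots> = 0" by (simp add: line)
  finally show ?thesis .
qed

section \<open>Superlevel sets of the density\<close>

locale even_log_concave_density =
  fixes n :: nat and f :: "(nat \<Rightarrow> real) \<Rightarrow> real"
  assumes n: "n \<ge> 1"
    and nonneg: "f x \<ge> 0"
    and total: "(\<integral>\<^sup>+x. ennreal (f x) \<partial>lebesgue_n n) = 1"
    and even: "x \<in> Rn n \<Longrightarrow> f (vneg x) = f x"
    and log_concave: "log_concave_on n f"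
begin

lemma log_concaveD:
  assumes "x \<in> Rn n" "y \<in> Rn n" "0 < t" "t < 1"
  shows "f x powr (1 - t) * f y powr t \<le> f (vadd (vscale (1 - t) x) (vscale t y))"
  using log_concave assms unfolding log_concave_on_def by auto

lemma superlevel_convex:
  assumes xy: "x \<in> Rn n" "y \<in> Rn n" and t: "0 \<le> t" "t \<le> 1" and c: "c \<le> f x" "c \<le> f y"
  shows "c \<le> f (vadd (vscale (1 - t) x) (vscale t y))"
proof -
  consider "c \<le> 0" | "t = 0" | "t = 1" | "c > 0" "0 < t" "t < 1" using t by force
  then show ?thesis
  proof cases
    case 1 then show ?thesis using nonneg order_trans by blast
  next
    case 2 then show ?thesis using c by (simp add: vec_defs)
  next
    case 3 then show ?thesis using c by (simp add: vec_defs)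
  next
    case 4
    have "c = c powr (1 - t) * c powr t" using 4 by (simp flip: powr_add)
    also have "\<dots> \<le> f x powr (1 - t) * f y powr t"
      using 4 c by (intro mult_mono powr_mono2) auto
    also have "\<dots> \<le> f (vadd (vscale (1 - t) x) (vscale t y))"
      using log_concaveD xy 4 by blast
    finally show ?thesis .
  qed
qed

text \<open>Evenness enters here: half of x - y is the midpoint of x and -y.\<close>

lemma superlevel_difference:
  assumes "x \<in> Rn n" "y \<in> Rn n" "c \<le> f x" "c \<le> f y"
  shows "c \<le> f (vscale (1 / 2) (vdiff x y))"
proof -
  have "vadd (vscale (1 - 1 / 2) x) (vscale (1 / 2) (vneg y)) = vscale (1 / 2) (vdiff x y)"
    by (auto simp: vec_defs fun_eq_iff algebra_simps)
  then show ?thesis using superlevel_convex[of x "vneg y" "1 / 2" c] assms even by simp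
qed

text \<open>The origin is the midpoint of x and -x.\<close>

lemma le_zero: "x \<in> Rn n \<Longrightarrow> f x \<le> f vzero"
  using superlevel_difference[of x x "f x"] by (simp add: vec_defs)

lemma antimono_ray:
  assumes x: "x \<in> Rn n" and "0 \<le> r" "r \<le> s"
  shows "f (vscale s x) \<le> f (vscale r x)"
proof (cases "s = 0")
  case False
  then have s: "s > 0" using assms by auto
  have "vadd (vscale (1 - r / s) vzero) (vscale (r / s) (vscale s x)) = vscale r x"
    using s by (auto simp: vec_defs)
  then show ?thesis
    using superlevel_convex[of vzero "vscale s x" "r / s" "f (vscale s x)"] le_zero[of "vscale s x"] s x assms
    by auto
qed (use assms in auto)

text \<open>Markov's inequality, for a measurable set inside the superlevel set because
  \<open>f\<close> is not assumed measurable.\<close>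

lemma superlevel_measure_le:
  assumes E: "E \<in> sets (\<Pi>\<^sub>M i\<in>{..<n}. (lborel :: real measure))" and c: "c > 0"
    and fE: "\<And>x. x \<in> E \<Longrightarrow> c \<le> f (zero_extend n x)"
  shows "ennreal c * emeasure (\<Pi>\<^sub>M i\<in>{..<n}. lborel) E \<le> 1"
proof -
  let ?P = "(\<Pi>\<^sub>M i\<in>{..<n}. (lborel :: real measure))"
  let ?B = "(\<Pi>\<^sub>M i\<in>UNIV. borel) :: (nat \<Rightarrow> real) measure"
  let ?res = "\<lambda>x. restrict x {..<n}"
  have res[measurable]: "?res \<in> ?B \<rightarrow>\<^sub>M ?P"
  proof (rule measurable_restrict)
    fix i show "(\<lambda>x. x i) \<in> ?B \<rightarrow>\<^sub>M lborel"
      using measurable_component_singleton[of i UNIV "\<lambda>_. borel :: real measure"] by simp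
  qed
  have Rn[measurable]: "Rn n \<in> sets ?B"
  proof -
    have "Rn n = (\<Inter>i\<in>{n..}. {x \<in> space ?B. x i = 0})" by (auto simp: Rn_def space_PiM)
    also have "\<dots> \<in> sets ?B"
      by (intro sets.countable_INT') auto
    finally show ?thesis .
  qed
  \<comment> \<open>\<open>E'\<close> is the copy of \<open>E\<close> in \<open>Rn n\<close>;
    restriction and \<open>zero_extend\<close> are inverse to each other by \<open>ze\<close> and
    \<open>rz\<close>.\<close>
  define E' where "E' = ?res -` E \<inter> space ?B \<inter> Rn n"
  have E'[measurable]: "E' \<in> sets ?B"
    unfolding E'_def using E by (intro sets.Int measurable_sets[OF res]) auto
  have ze: "zero_extend n (?res x) = x" if "x \<in> Rn n" for x
    using that by (auto simp: zero_extend_def Rn_def fun_eq_iff)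
  have rz: "?res (zero_extend n x) = x" if "x \<in> space ?P" for x
    using that by (auto simp: zero_extend_def space_PiM fun_eq_iff restrict_def PiE_def extensional_def)
  have pre: "zero_extend n -` E' \<inter> space ?P = E"
    using rz sets.sets_into_space[OF E] by (auto simp: E'_def space_PiM)
  have "ennreal c * emeasure ?P E = ennreal c * emeasure (distr ?P ?B (zero_extend n)) E'"
    by (simp add: emeasure_distr pre)
  also have "\<dots> = (\<integral>\<^sup>+x. ennreal c * indicator E' x \<partial>distr ?P ?B (zero_extend n))"
    by (subst nn_integral_cmult_indicator) auto
  also have "\<dots> \<le> (\<integral>\<^sup>+x. ennreal (f x) \<partial>distr ?P ?B (zero_extend n))"
  proof (rule nn_integral_mono)
    fix x
    show "ennreal c * indicator E' x \<le> ennreal (f x)"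
    proof (cases "x \<in> E'")
      case True
      then have "?res x \<in> E" "x \<in> Rn n" by (auto simp: E'_def)
      then show ?thesis using fE[of "?res x"] ze[of x] True by (simp add: ennreal_leI)
    qed auto
  qed
  also have "\<dots> = 1" using total by (simp add: nn_integral_lebesgue_n)
  finally show ?thesis .
qed

text \<open>A positive lower integral provides a simple function below \<open>f\<close> with
  positive integral; \<open>E\<close> is the preimage of the set where that function is
  positive.\<close>

lemma positive_on_positive_measure:
  obtains E where "E \<in> sets (\<Pi>\<^sub>M i\<in>{..<n}. (lborel :: real measure))"
    "emeasure (\<Pi>\<^sub>M i\<in>{..<n}. lborel) E > 0" "\<And>x. x \<in> E \<Longrightarrow> f (zero_extend n x) > 0"
proof -
  let ?P = "(\<Pi>\<^sub>M i\<in>{..<n}. (lborel :: real measure))"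
  let ?B = "(\<Pi>\<^sub>M i\<in>UNIV. borel) :: (nat \<Rightarrow> real) measure"
  let ?D = "distr ?P ?B (zero_extend n)"
  have "0 < (\<integral>\<^sup>+x. ennreal (f x) \<partial>?D)" using total by (simp add: nn_integral_lebesgue_n)
  then obtain g where g: "simple_function ?D g" "g \<le> (\<lambda>x. ennreal (f x))" "0 < integral\<^sup>S ?D g"
    unfolding nn_integral_def by (auto simp: less_SUP_iff)
  define S where "S = {x \<in> space ?D. 0 < g x}"
  have gm: "g \<in> borel_measurable ?D" using g(1) by (rule borel_measurable_simple_function)
  have "S \<in> sets ?D" unfolding S_def using gm by measurable
  then have S: "S \<in> sets ?B" by simp
  have pos: "emeasure ?D S > 0"
  proof (rule ccontr)
    assume "\<not> emeasure ?D S > 0"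
    then have "S \<in> null_sets ?D" using S by auto
    then have "AE x in ?D. g x = 0"
      by (rule AE_I') (auto simp: S_def zero_less_iff_neq_zero)
    then have "integral\<^sup>N ?D g = 0" using gm by (simp add: nn_integral_0_iff_AE)
    then show False using g nn_integral_eq_simple_integral[OF g(1)] by simp
  qed
  show ?thesis
  proof (rule that[of "zero_extend n -` S \<inter> space ?P"])
    show "zero_extend n -` S \<inter> space ?P \<in> sets ?P" using S by measurable
    show "emeasure ?P (zero_extend n -` S \<inter> space ?P) > 0"
      using pos S by (simp add: emeasure_distr)
    show "f (zero_extend n x) > 0" if "x \<in> zero_extend n -` S \<inter> space ?P" for x
    proof -
      have "0 < g (zero_extend n x)" using that by (simp add: S_def)
      also have "\<dots> \<le> ennreal (f (zero_extend n x))" using g(2) by (simp add: le_fun_def)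
      finally show ?thesis by simp
    qed
  qed
qed

text \<open>If the positivity set contained no multiple of a coordinate vector, then by convexity and
  symmetry it would meet each line in that direction at most once and hence be null.\<close>

lemma positive_on_axis:
  assumes i: "i < n"
  shows "\<exists>\<epsilon>>0. f (vscale \<epsilon> (unit_vec i)) > 0"
proof (rule ccontr)
  assume neg: "\<not> ?thesis"
  obtain E where E: "E \<in> sets (\<Pi>\<^sub>M i\<in>{..<n}. (lborel :: real measure))"
    "emeasure (\<Pi>\<^sub>M i\<in>{..<n}. lborel) E > 0" "\<And>x. x \<in> E \<Longrightarrow> f (zero_extend n x) > 0"
    using positive_on_positive_measure by blast
  have le: "z \<le> y" if "x(i := y) \<in> E" "x(i := z) \<in> E" for x y z
  proof (rule ccontr)
    assume "\<not> z \<le> y"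
    then have zy: "(z - y) / 2 > 0" by simp
    let ?p = "zero_extend n (x(i := z))" and ?q = "zero_extend n (x(i := y))"
    have eq: "vscale (1 / 2) (vdiff ?p ?q) = vscale ((z - y) / 2) (unit_vec i)"
      using i by (auto simp: vec_defs zero_extend_def unit_vec_def fun_eq_iff)
    have "0 < min (f ?p) (f ?q)" using E(3) that by simp
    also have "\<dots> \<le> f (vscale ((z - y) / 2) (unit_vec i))"
      unfolding eq[symmetric] by (rule superlevel_difference) auto
    finally show False using neg zy by blast
  qed
  have "emeasure (\<Pi>\<^sub>M i\<in>{..<n}. (lborel :: real measure)) E = 0"
    by (rule emeasure_PiM_at_most_one_per_line[OF E(1) i]) (use le in \<open>auto intro: antisym\<close>)
  then show False using E(2) by simp
qed

text \<open>\<open>x\<close> is the mean of the \<open>k\<close> axis points k x_i e_i, each within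
  \<open>\<epsilon>\<close> of the origin, so convexity suffices. The induction splits off the last
  of them with weight 1/(k+1).\<close>

lemma box_average:
  assumes axis: "\<And>i. i < n \<Longrightarrow> c \<le> f (vscale \<epsilon> (unit_vec i))" and \<epsilon>: "\<epsilon> > 0" and c: "c \<le> f vzero"
    and x: "k \<le> n" "\<And>i. i \<ge> k \<Longrightarrow> x i = 0" "\<And>i. real k * \<bar>x i\<bar> \<le> \<epsilon>"
  shows "c \<le> f x"
  using x
proof (induction k arbitrary: x)
  case 0
  then have "x = vzero" by (auto simp: vec_defs)
  then show ?case using c by simp
next
  case (Suc k)
  define t where "t = 1 / real (Suc k)"
  have t: "0 < t" "t \<le> 1" "1 - t = real k / real (Suc k)" by (auto simp: t_def field_simps)
  \<comment> \<open>For \<open>k\<close> = 0 the divisor \<open>1 - t\<close> is 0, but then no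
    index is below \<open>k\<close> and \<open>u\<close> is the origin.\<close>
  define u where "u = (\<lambda>i. if i < k then x i / (1 - t) else 0)"
  define v where "v = vscale (real (Suc k) * x k) (unit_vec k)"
  have k: "k < n" using Suc.prems by simp
  have "c \<le> f u"
  proof (rule Suc.IH)
    show "real k * \<bar>u i\<bar> \<le> \<epsilon>" for i
    proof (cases "i < k")
      case True
      then have "real k * \<bar>u i\<bar> = real (Suc k) * \<bar>x i\<bar>"
        by (simp add: u_def t(3) abs_mult abs_divide del: of_nat_Suc)
      then show ?thesis using Suc.prems(3)[of i] by simp
    qed (use \<epsilon> in \<open>simp add: u_def\<close>)
  qed (use k in \<open>auto simp: u_def\<close>)
  moreover have "c \<le> f v"
  proof -
    have "\<bar>real (Suc k) * x k\<bar> \<le> \<epsilon>" using Suc.prems(3)[of k] by (simp add: abs_mult)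
    then have "f (vscale \<epsilon> (unit_vec k)) \<le> f (vscale \<bar>real (Suc k) * x k\<bar> (unit_vec k))"
      using k by (intro antimono_ray) auto
    moreover have "f (vscale \<bar>real (Suc k) * x k\<bar> (unit_vec k)) = f v"
    proof (cases "real (Suc k) * x k \<ge> 0")
      case False
      then have "vscale \<bar>real (Suc k) * x k\<bar> (unit_vec k) = vneg v"
        by (auto simp: v_def vec_defs fun_eq_iff)
      then show ?thesis using even[of v] k by (simp add: v_def)
    qed (simp add: v_def)
    ultimately show ?thesis using axis[OF k] by simp
  qed
  moreover have "u \<in> Rn n" "v \<in> Rn n" using k by (auto simp: u_def v_def Rn_def vec_defs unit_vec_def)
  moreover have "vadd (vscale (1 - t) u) (vscale t v) = x"
  proof
    fix i
    consider "i < k" | "i = k" | "i > k" by linarith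
    then show "vadd (vscale (1 - t) u) (vscale t v) i = x i"
    proof cases
      case 1 then have "1 - t \<noteq> 0" using t by auto
      then show ?thesis using 1 by (simp add: vec_defs u_def v_def unit_vec_def)
    next
      case 2
      have "t * real (Suc k) = 1" by (simp add: t_def)
      then show ?thesis using 2 by (simp add: vec_defs u_def v_def unit_vec_def flip: mult.assoc del: of_nat_Suc)
    next
      case 3 then show ?thesis using Suc.prems(2)[of i] by (simp add: vec_defs u_def v_def unit_vec_def)
    qed
  qed
  ultimately show ?case using superlevel_convex[of u v t c] t by auto
qed

lemma zero_pos: "f vzero > 0"
  using positive_on_axis[of 0] le_zero[of "vscale \<epsilon> (unit_vec 0)" for \<epsilon>] n
  by (metis Rn_closed(2) less_le_trans unit_vec_Rn zero_less_one)

text \<open>\<open>c\<close> is at most half the maximum so that outside its superlevel set f has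
  dropped to f(0)/2, the input of \<open>exponential_decay\<close>. The box comes from
  \<open>box_average\<close> with all n coordinates, hence the side bound
  \<open>\<epsilon> / n\<close>.\<close>

lemma box_lower_bound:
  obtains \<delta> c where "\<delta> > 0" "c > 0" "c \<le> f vzero / 2"
    "\<And>x. x \<in> Rn n \<Longrightarrow> (\<And>i. i < n \<Longrightarrow> \<bar>x i\<bar> \<le> \<delta>) \<Longrightarrow> c \<le> f x"
proof -
  obtain e where e: "\<And>i. i < n \<Longrightarrow> e i > 0 \<and> f (vscale (e i) (unit_vec i)) > 0"
    using positive_on_axis by metis
  have ne: "{..<n} \<noteq> {}" using n by (auto simp: lessThan_empty_iff)
  define \<epsilon> where "\<epsilon> = Min (e ` {..<n})"
  have \<epsilon>: "\<epsilon> > 0" using e ne by (auto simp: \<epsilon>_def)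
  have f\<epsilon>: "f (vscale \<epsilon> (unit_vec i)) > 0" if "i < n" for i
  proof -
    have "\<epsilon> \<le> e i" using that by (auto simp: \<epsilon>_def)
    then show ?thesis using antimono_ray[of "unit_vec i" \<epsilon> "e i"] e[OF that] that \<epsilon> by force
  qed
  define c where "c = Min (insert (f vzero / 2) ((\<lambda>i. f (vscale \<epsilon> (unit_vec i))) ` {..<n}))"
  have c: "c > 0" "\<And>i. i < n \<Longrightarrow> c \<le> f (vscale \<epsilon> (unit_vec i))"
    using f\<epsilon> zero_pos by (auto simp: c_def)
  have c2: "c \<le> f vzero / 2" unfolding c_def by (rule Min_le) auto
  show ?thesis
  proof (rule that[of "\<epsilon> / n" c])
    show "\<epsilon> / n > 0" using \<epsilon> n by simp
    show "c \<le> f x" if "x \<in> Rn n" "\<And>i. i < n \<Longrightarrow> \<bar>x i\<bar> \<le> \<epsilon> / n" for x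
    proof (rule box_average[where k=n and \<epsilon>=\<epsilon>, OF c(2) \<epsilon>])
      show "real n * \<bar>x i\<bar> \<le> \<epsilon>" for i
        using that n \<epsilon> by (cases "i < n") (auto simp: Rn_def field_simps)
      show "x i = 0" if "i \<ge> n" for i using \<open>x \<in> Rn n\<close> that by (auto simp: Rn_def)
    qed (use c2 zero_pos in auto)
  qed (use c c2 in auto)
qed

text \<open>A far-away point of a superlevel set that contains a box forces many disjoint translates of
  half the box into that set.\<close>

lemma superlevel_bounded:
  assumes \<delta>: "\<delta> > 0" and c: "c > 0"
    and box: "\<And>x. x \<in> Rn n \<Longrightarrow> (\<And>i. i < n \<Longrightarrow> \<bar>x i\<bar> \<le> \<delta>) \<Longrightarrow> c \<le> f x"
  obtains M where "M > 0" "\<And>z j. z \<in> Rn n \<Longrightarrow> j < n \<Longrightarrow> c \<le> f z \<Longrightarrow> \<bar>z j\<bar> \<le> M"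
proof -
  let ?P = "(\<Pi>\<^sub>M i\<in>{..<n}. (lborel :: real measure))"
  \<comment> \<open>\<open>N\<close> disjoint cubes of volume \<delta>^n on which f \<ge> c would
    carry mass above 1.\<close>
  obtain N :: nat where N: "1 / (c * \<delta> ^ n) < real N" using reals_Archimedean2 by blast
  have N0: "N > 0"
  proof -
    have "0 < 1 / (c * \<delta> ^ n)" using c \<delta> by simp
    then show ?thesis using N by (metis less_trans of_nat_0_less_iff)
  qed
  have "\<bar>z j\<bar> \<le> 2 * real N * \<delta>" if z: "z \<in> Rn n" "j < n" "c \<le> f z" for z j
  proof (rule ccontr)
    assume far: "\<not> ?thesis"
    \<comment> \<open>The cubes are centred at t_k z. Consecutive centres differ in coordinate
      \<open>j\<close> by |z_j|/(2N) > \<delta>, the side length, and t_k \<le> 1/2 leaves room for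
      half the box in the hull of the box and z.\<close>
    define t where "t = (\<lambda>k::nat. real k / (2 * real N))"
    define Q where "Q = (\<lambda>k. \<Pi>\<^sub>E i\<in>{..<n}. {t k * z i - \<delta> / 2 .. t k * z i + \<delta> / 2})"
    have Q: "Q k \<in> sets ?P" for k unfolding Q_def by (intro sets_PiM_I_finite) auto
    have mQ: "emeasure ?P (Q k) = ennreal (\<delta> ^ n)" for k
    proof -
      have "emeasure ?P (Q k) = (\<Prod>i<n. emeasure lborel {t k * z i - \<delta> / 2 .. t k * z i + \<delta> / 2})"
        unfolding Q_def by (rule lborel_product.emeasure_PiM) auto
      also have "\<dots> = ennreal (\<delta> ^ n)" using \<delta> by (simp add: ennreal_power)
      finally show ?thesis .
    qed
    have Q_near: "\<bar>x i - t k * z i\<bar> \<le> \<delta> / 2" if "x \<in> Q k" "i < n" for x k i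
    proof -
      have "x i \<in> {t k * z i - \<delta> / 2 .. t k * z i + \<delta> / 2}"
        using that PiE_mem[of x "{..<n}" _ i] unfolding Q_def by blast
      then show ?thesis unfolding abs_le_iff by auto
    qed
    have disj: "disjoint_family_on Q {..<N}"
      unfolding disjoint_family_on_def
    proof (intro ballI impI, rule ccontr)
      fix k l assume kl: "k \<noteq> l" and "Q k \<inter> Q l \<noteq> {}"
      then obtain x where "x \<in> Q k" "x \<in> Q l" by blast
      then have "\<bar>x j - t k * z j\<bar> \<le> \<delta> / 2" "\<bar>x j - t l * z j\<bar> \<le> \<delta> / 2"
        using Q_near z(2) by blast+
      then have "\<bar>t k * z j - t l * z j\<bar> \<le> \<delta>" by linarith
      then have "\<bar>t k - t l\<bar> * \<bar>z j\<bar> \<le> \<delta>" by (simp add: left_diff_distrib flip: abs_mult)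
      moreover have "1 / (2 * real N) \<le> \<bar>t k - t l\<bar>"
      proof -
        have "1 \<le> \<bar>real k - real l\<bar>" using kl by linarith
        then have "1 / (2 * real N) \<le> \<bar>real k - real l\<bar> / (2 * real N)" by (intro divide_right_mono) auto
        then show ?thesis by (simp add: t_def flip: diff_divide_distrib)
      qed
      ultimately have "1 / (2 * real N) * \<bar>z j\<bar> \<le> \<delta>"
        by (meson abs_ge_zero mult_right_mono order_trans)
      then show False using far N0 by (simp add: field_simps)
    qed
    define E where "E = (\<Union>k<N. Q k)"
    have E: "E \<in> sets ?P" unfolding E_def using Q by auto
    have mE: "emeasure ?P E = ennreal (real N * \<delta> ^ n)"
    proof -
      have "emeasure ?P E = (\<Sum>k<N. emeasure ?P (Q k))"
        unfolding E_def using Q disj by (intro sum_emeasure[symmetric]) auto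
      then show ?thesis using \<delta> by (simp add: mQ ennreal_mult ennreal_of_nat_eq_real_of_nat)
    qed
    have "ennreal c * emeasure ?P E \<le> 1"
    proof (rule superlevel_measure_le[OF E c])
      fix x assume "x \<in> E"
      then obtain k where k: "k < N" "x \<in> Q k" by (auto simp: E_def)
      have t: "0 \<le> t k" "t k \<le> 1 / 2" using k by (auto simp: t_def field_simps)
      \<comment> \<open>\<open>b\<close> solves x = (1 - t_k) b + t_k z; it lies in the box because
        |x_i - t_k z_i| \<le> \<delta>/2 \<le> (1 - t_k) \<delta>.\<close>
      define b where "b = vscale (1 / (1 - t k)) (vdiff (zero_extend n x) (vscale (t k) z))"
      have bR: "b \<in> Rn n" using z by (simp add: b_def)
      have "c \<le> f b"
      proof (rule box[OF bR])
        fix i assume i: "i < n"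
        then have "\<bar>x i - t k * z i\<bar> \<le> \<delta> / 2" using Q_near k(2) by blast
        moreover have "\<delta> * (1 / 2) \<le> \<delta> * (1 - t k)" using t \<delta> by (intro mult_left_mono) auto
        ultimately have "\<bar>x i - t k * z i\<bar> \<le> \<delta> * (1 - t k)" by linarith
        then show "\<bar>b i\<bar> \<le> \<delta>" using i t
          by (simp add: b_def vec_defs zero_extend_def abs_mult field_simps)
      qed
      moreover have "vadd (vscale (1 - t k) b) (vscale (t k) z) = zero_extend n x"
        using t by (auto simp: b_def vec_defs fun_eq_iff)
      ultimately show "c \<le> f (zero_extend n x)"
        using superlevel_convex[of b z "t k" c] bR z t by auto
    qed
    then have "ennreal (c * (real N * \<delta> ^ n)) \<le> ennreal 1"
      using c \<delta> by (simp add: mE ennreal_mult)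
    then have "c * (real N * \<delta> ^ n) \<le> 1" by (simp add: ennreal_le_iff)
    then show False using N c \<delta> by (simp add: field_simps)
  qed
  then show ?thesis using that[of "2 * real N * \<delta>"] N0 \<delta> by auto
qed

end

section \<open>The gauge as a norm\<close>

context even_log_concave_density
begin

section \<open>Radial integrals of the density: finiteness and positivity\<close>

abbreviation "N \<equiv> Kf_norm n f"

text \<open>For r \<ge> 0 this is f(x) 1(|u| \<le> 1) along the ray through (x, 1).\<close>

definition unit_ray :: "(nat \<Rightarrow> real) \<Rightarrow> real \<Rightarrow> real" where
  "unit_ray x = (\<lambda>r. if r \<le> 1 then f (vscale r x) else 0)"

lemma rad_int_eq: "rad_int n f {0..} x = ray_integral n (\<lambda>r. f (vscale r x))"
  by (simp add: rad_int_def ray_integral_def nn_integral_completion)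

lemma rad_int_unit_eq: "rad_int n f {0..1} x = ray_integral n (unit_ray x)"
  unfolding rad_int_def ray_integral_def nn_integral_completion
  by (intro nn_integral_cong) (auto simp: indicator_def unit_ray_def)

lemma vscale_combination:
  "vscale ((1 - t) * r + t * s) x = vadd (vscale (1 - t) (vscale r x)) (vscale t (vscale s x))"
  by (auto simp: vec_defs algebra_simps)

lemma ray_profile_f:
  assumes x: "x \<in> Rn n"
  shows "ray_profile (\<lambda>r. f (vscale r x))"
  unfolding ray_profile_def
proof (intro conjI allI impI; (elim conjE)?)
  show "antimono_on {0..} (\<lambda>r. f (vscale r x))"
    using antimono_ray[OF x] by (auto simp: monotone_on_def)
  obtain \<delta> c where \<delta>: "\<delta> > 0" "c > 0"
    "\<And>x. x \<in> Rn n \<Longrightarrow> (\<And>i. i < n \<Longrightarrow> \<bar>x i\<bar> \<le> \<delta>) \<Longrightarrow> c \<le> f x"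
    using box_lower_bound by metis
  define S where "S = 1 + (\<Sum>i<n. \<bar>x i\<bar>)"
  have S: "S > 0" unfolding S_def by (intro add_pos_nonneg sum_nonneg) auto
  have xS: "\<bar>x i\<bar> \<le> S" if "i < n" for i
    using member_le_sum[of i "{..<n}" "\<lambda>i. \<bar>x i\<bar>"] that by (simp add: S_def)
  have "c \<le> f (vscale (\<delta> / S) x)"
  proof (rule \<delta>(3))
    show "\<bar>vscale (\<delta> / S) x i\<bar> \<le> \<delta>" if "i < n" for i
      using xS[OF that] S \<delta>(1) by (simp add: vscale_def abs_mult field_simps)
  qed (use x in simp)
  then show "\<exists>\<delta>>0. 0 < f (vscale \<delta> x)"
    using \<delta> S by (intro exI[of _ "\<delta> / S"]) auto
  fix r s t :: real assume "0 < t" "t < 1"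
  then show "f (vscale r x) powr (1 - t) * f (vscale s x) powr t \<le> f (vscale ((1 - t) * r + t * s) x)"
    unfolding vscale_combination using x by (intro log_concaveD) auto
qed (rule nonneg)

lemma ray_profile_unit_ray: "x \<in> Rn n \<Longrightarrow> ray_profile (unit_ray x)"
  unfolding unit_ray_def by (rule ray_profile_truncate[OF ray_profile_f])

text \<open>With the weights s/(r+s) and r/(r+s) on r x and s y, both x and y receive the
  coefficient rs/(r+s).\<close>

lemma f_harmonic:
  assumes "x \<in> Rn n" "y \<in> Rn n" "r > 0" "s > 0"
  shows "f (vscale r x) powr (s / (r + s)) * f (vscale s y) powr (r / (r + s))
    \<le> f (vscale (r * s / (r + s)) (vadd x y))"
proof -
  define t where "t = r / (r + s)"
  have t: "0 < t" "t < 1" "s / (r + s) = 1 - t" using assms by (auto simp: t_def field_simps)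
  have "vadd (vscale (s / (r + s)) (vscale r x)) (vscale (r / (r + s)) (vscale s y)) =
      vscale (r * s / (r + s)) (vadd x y)"
    by (auto simp: vec_defs algebra_simps add_divide_distrib)
  then have "vadd (vscale (1 - t) (vscale r x)) (vscale t (vscale s y)) = vscale (r * s / (r + s)) (vadd x y)"
    by (simp only: t(3) t_def[symmetric])
  then show ?thesis
    using log_concaveD[of "vscale r x" "vscale s y" t] assms t(1,2) by (simp only: t(3) t_def[symmetric] Rn_closed)
qed

text \<open>\<open>f\<close> is largest at the origin; this is the source of f(0)^(1/n) in the
  Lipschitz bound.\<close>

lemma rad_int_unit_le: "x \<in> Rn n \<Longrightarrow> rad_int n f {0..1} x \<le> ennreal (f vzero / n)"
  unfolding nn_integral_power_unit_interval[OF n nonneg, symmetric] rad_int_def nn_integral_completion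
  by (intro nn_integral_mono) (auto simp: indicator_def intro!: ennreal_leI mult_right_mono le_zero)

lemma rad_int_unit_mono: "rad_int n f {0..1} x \<le> rad_int n f {0..} x"
  unfolding rad_int_def by (intro nn_integral_mono) (auto simp: indicator_def)

lemma rad_int_unit_finite: "x \<in> Rn n \<Longrightarrow> rad_int n f {0..1} x \<noteq> \<infinity>"
  using rad_int_unit_le[of x] by (auto simp: top_unique)

text \<open>Beyond \<open>M\<close>, log-concavity between 0 and r x at the intermediate point M x
  turns one halving into f(r x) \<le> f(0) 2^(-r/M). The factor 2 extends the bound to r \<le> M,
  where f \<le> f(0) is all that is used.\<close>

lemma exponential_decay:
  assumes M: "M > 0" and x: "x \<in> Rn n" and half: "f (vscale M x) \<le> f vzero / 2" and r: "r \<ge> 0"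
  shows "f (vscale r x) \<le> 2 * f vzero * exp (- (ln 2 / M * r))"
proof (cases "r \<le> M")
  case True
  have "1 / 2 = exp (- (ln 2 :: real))" by (simp add: exp_minus)
  also have "\<dots> \<le> exp (- (ln 2 / M * r))"
    using True M r by (simp add: field_simps)
  finally have "1 \<le> 2 * exp (- (ln 2 / M * r))" by simp
  then have "f vzero * 1 \<le> f vzero * (2 * exp (- (ln 2 / M * r)))"
    using zero_pos by (intro mult_left_mono) auto
  then show ?thesis using le_zero[of "vscale r x"] x by simp
next
  case False
  define t where "t = M / r"
  have t: "0 < t" "t < 1" using False M by (auto simp: t_def)
  have "vadd (vscale (1 - t) vzero) (vscale t (vscale r x)) = vscale M x"
    using False M by (auto simp: vec_defs t_def)
  then have "f vzero powr (1 - t) * f (vscale r x) powr t \<le> f vzero / 2"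
    using log_concaveD[of vzero "vscale r x" t] x t half by auto
  moreover have "f vzero = f vzero powr (1 - t) * f vzero powr t"
    using zero_pos by (simp flip: powr_add)
  ultimately have "f vzero powr (1 - t) * f (vscale r x) powr t \<le> f vzero powr (1 - t) * (f vzero powr t / 2)"
    by simp
  then have le: "f (vscale r x) powr t \<le> f vzero powr t / 2"
    using zero_pos by (subst (asm) mult_le_cancel_left_pos) auto
  have "f (vscale r x) = (f (vscale r x) powr t) powr (1 / t)"
    using t nonneg by (simp add: powr_powr)
  also have "\<dots> \<le> (f vzero powr t / 2) powr (1 / t)"
    using le t by (intro powr_mono2) auto
  also have "\<dots> = f vzero * (1 / 2) powr (1 / t)"
    using t zero_pos powr_mult[of "f vzero powr t" "1 / 2" "1 / t"] by (simp add: powr_powr)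
  also have "(1 / 2) powr (1 / t) = exp (- (ln 2 / M * r))"
    by (simp add: powr_def t_def ln_div field_simps)
  also have "f vzero * exp (- (ln 2 / M * r)) \<le> 2 * f vzero * exp (- (ln 2 / M * r))"
    using zero_pos by simp
  finally show ?thesis .
qed

text \<open>One radius takes every ray with |x_j| \<ge> 1 out of a fixed superlevel set, so the
  decay rate is uniform in x. After rescaling, this gives both the finiteness of the gauge integral
  and \<open>coordinate_le_N\<close>.\<close>

lemma rad_int_uniform_bound:
  obtains Q where "Q > 0" "\<And>x j. x \<in> Rn n \<Longrightarrow> j < n \<Longrightarrow> 1 \<le> \<bar>x j\<bar> \<Longrightarrow> rad_int n f {0..} x \<le> ennreal Q"
proof -
  obtain \<delta> c where \<delta>: "\<delta> > 0" "c > 0" "c \<le> f vzero / 2"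
    "\<And>x. x \<in> Rn n \<Longrightarrow> (\<And>i. i < n \<Longrightarrow> \<bar>x i\<bar> \<le> \<delta>) \<Longrightarrow> c \<le> f x"
    using box_lower_bound by metis
  obtain M where M: "M > 0" "\<And>z j. z \<in> Rn n \<Longrightarrow> j < n \<Longrightarrow> c \<le> f z \<Longrightarrow> \<bar>z j\<bar> \<le> M"
    using superlevel_bounded[OF \<delta>(1,2,4)] by metis
  \<comment> \<open>Adding 1 makes M1 |x_j| > M strict.\<close>
  define M1 where "M1 = M + 1"
  have M1: "M1 > 0" using M by (simp add: M1_def)
  obtain Q where Q: "Q > 0"
    "(\<integral>\<^sup>+r\<in>{0..}. ennreal (2 * f vzero * exp (- (ln 2 / M1 * r)) * r ^ (n - 1)) \<partial>lborel) \<le> ennreal Q"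
    using nn_integral_exp_power_finite[of "ln 2 / M1" "2 * f vzero" n] M1 zero_pos by auto
  show ?thesis
  proof (rule that[OF Q(1)])
    fix x j assume x: "x \<in> Rn n" "j < n" "1 \<le> \<bar>x j\<bar>"
    have "M1 * 1 \<le> M1 * \<bar>x j\<bar>" using x M1 by (intro mult_left_mono) auto
    then have "M < M1 * \<bar>x j\<bar>" by (simp add: M1_def)
    then have "M < \<bar>vscale M1 x j\<bar>" using M1 by (simp add: vscale_def abs_mult)
    then have "\<not> c \<le> f (vscale M1 x)" using M(2)[of "vscale M1 x" j] x by auto
    then have half: "f (vscale M1 x) \<le> f vzero / 2" using \<delta> by simp
    have "rad_int n f {0..} x \<le>
      (\<integral>\<^sup>+r\<in>{0..}. ennreal (2 * f vzero * exp (- (ln 2 / M1 * r)) * r ^ (n - 1)) \<partial>lborel)"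
      unfolding rad_int_def nn_integral_completion
      using exponential_decay[OF M1 x(1) half]
      by (intro nn_integral_mono) (auto simp: indicator_def intro!: ennreal_leI mult_right_mono)
    then show "rad_int n f {0..} x \<le> ennreal Q" using Q(2) by (rule order_trans)
  qed
qed

lemma rad_int_scale:
  assumes "x \<in> Rn n" "c > 0"
  shows "rad_int n f {0..} x = ennreal (c ^ n) * rad_int n f {0..} (vscale c x)"
proof -
  have "(\<lambda>r. f (vscale (c * r) x)) = (\<lambda>r. f (vscale r (vscale c x)))"
    by (auto simp: vec_defs ac_simps)
  then show ?thesis unfolding rad_int_eq
    using ray_integral_scale[OF assms(2) n ray_profile_measurable[OF ray_profile_f[OF assms(1)]]] by simp
qed

lemma nonzero_coordinate:
  assumes "x \<in> Rn n" "x \<noteq> vzero"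
  obtains j where "j < n" "x j \<noteq> 0"
  using assms by (auto simp: Rn_def vzero_def fun_eq_iff) (metis not_le)

lemma rad_int_finite:
  assumes x: "x \<in> Rn n" "x \<noteq> vzero"
  shows "rad_int n f {0..} x \<noteq> \<infinity>"
proof -
  obtain j where j: "j < n" "x j \<noteq> 0" using nonzero_coordinate[OF x] .
  obtain Q where Q: "\<And>x j. x \<in> Rn n \<Longrightarrow> j < n \<Longrightarrow> 1 \<le> \<bar>x j\<bar> \<Longrightarrow> rad_int n f {0..} x \<le> ennreal Q"
    using rad_int_uniform_bound by metis
  have "rad_int n f {0..} (vscale (1 / \<bar>x j\<bar>) x) \<le> ennreal Q"
    using j x(1) by (intro Q[of _ j] Rn_closed) (auto simp: vscale_def)
  then have "rad_int n f {0..} (vscale (1 / \<bar>x j\<bar>) x) < \<infinity>" by (auto intro: le_less_trans)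
  then show ?thesis using rad_int_scale[OF x(1), of "1 / \<bar>x j\<bar>"] j
    by (auto simp: ennreal_mult_eq_top_iff)
qed

lemma rad_int_unit_pos:
  assumes x: "x \<in> Rn n"
  shows "enn2real (rad_int n f {0..1} x) > 0"
proof -
  have fin: "ray_integral n (unit_ray x) \<noteq> \<infinity>" using rad_int_unit_finite[OF x] by (simp add: rad_int_unit_eq)
  obtain a where a: "\<And>k. a k > 0" "\<And>k. continuous_on {0..a k} (unit_ray x)"
    "\<And>k r. 0 \<le> r \<Longrightarrow> r \<le> a k \<Longrightarrow> unit_ray x r > 0"
    "\<And>k::nat. integral {0..a k} (\<lambda>r. unit_ray x r * r ^ (n - 1)) \<le> enn2real (ray_integral n (unit_ray x))"
    by (rule ray_integral_limit[OF ray_profile_unit_ray[OF x] fin]) blast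
  have "0 < integral {0..a 0} (\<lambda>r. unit_ray x r * r ^ (n - 1))"
    using a(3)[where k=0] by (intro uniform_transport(1) a continuous_intros mult_pos_pos) auto
  then show ?thesis using a(4)[of 0] by (simp add: rad_int_unit_eq)
qed

lemma rad_int_pos:
  assumes "x \<in> Rn n" "x \<noteq> vzero"
  shows "enn2real (rad_int n f {0..} x) > 0"
proof -
  have "enn2real (rad_int n f {0..1} x) \<le> enn2real (rad_int n f {0..} x)"
    using rad_int_finite[OF assms] by (intro enn2real_mono[OF rad_int_unit_mono]) (simp add: less_top)
  then show ?thesis using rad_int_unit_pos[OF assms(1)] by linarith
qed

section \<open>The norm axioms and the comparison with the coordinates\<close>

lemma N_nonzero: "x \<in> Rn n \<Longrightarrow> x \<noteq> vzero \<Longrightarrow> N x = (n * enn2real (rad_int n f {0..} x)) powr (- 1 / n)"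
  using rad_int_finite unfolding Kf_norm_def by auto

lemma N_pos: "x \<in> Rn n \<Longrightarrow> x \<noteq> vzero \<Longrightarrow> N x > 0"
  using rad_int_pos[of x] n by (simp add: N_nonzero)

lemma N_nonneg: "N x \<ge> 0"
  by (simp add: Kf_norm_def)

text \<open>The radial integral at the origin is nonzero and, by scaling with 2, equals 2^n times
  itself; so it is infinite and the convention in \<open>Kf_norm\<close> applies.\<close>

lemma N_vzero [simp]: "N vzero = 0"
proof -
  have "vscale r vzero = vzero" for r by (simp add: vec_defs)
  then have "rad_int n f {0..} vzero = ennreal (2 ^ n) * rad_int n f {0..} vzero"
    using rad_int_scale[of vzero 2] by simp
  moreover have "rad_int n f {0..} vzero \<noteq> 0"
  proof -
    have "rad_int n f {0..1} vzero \<noteq> 0" using rad_int_unit_pos[of vzero] by auto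
    then show ?thesis using rad_int_unit_mono[of vzero] by auto
  qed
  moreover have "x = \<infinity>" if "x = ennreal (2 ^ n) * x" "x \<noteq> 0" for x
  proof (rule ccontr)
    assume "x \<noteq> \<infinity>"
    then obtain y where y: "x = ennreal y" "y \<ge> 0" by (cases x) auto
    then have "y = 2 ^ n * y" using that by (simp flip: ennreal_mult')
    moreover have "(2::real) ^ n > 1" using n by (simp add: one_less_power)
    ultimately show False using that y by simp
  qed
  ultimately show ?thesis unfolding Kf_norm_def by auto
qed

lemma N_scale:
  assumes x: "x \<in> Rn n" and c: "c \<ge> 0"
  shows "N (vscale c x) = c * N x"
proof (cases "c = 0 \<or> x = vzero")
  case True
  then have "vscale c x = vzero" by (auto simp: vec_defs)
  then show ?thesis using True by auto
next
  case False
  then have c: "c > 0" and x0: "x \<noteq> vzero" using c by auto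
  then have cx: "vscale c x \<noteq> vzero" by (auto simp: vec_defs fun_eq_iff)
  let ?R = "rad_int n f {0..}"
  have "enn2real (?R x) = c ^ n * enn2real (?R (vscale c x))"
    unfolding rad_int_scale[OF x c] using c by (simp add: enn2real_mult)
  then have "N x = (c ^ n) powr (- 1 / n) * N (vscale c x)"
    using x x0 cx c by (simp add: N_nonzero powr_mult ac_simps)
  also have "(c ^ n) powr (- 1 / n) = 1 / c"
    using c n by (simp add: powr_powr powr_minus_divide flip: powr_realpow)
  finally show ?thesis using c by simp
qed

lemma N_vneg: "x \<in> Rn n \<Longrightarrow> N (vneg x) = N x"
proof -
  assume x: "x \<in> Rn n"
  have "vscale r (vneg x) = vneg (vscale r x)" for r by (auto simp: vec_defs)
  then have "rad_int n f {0..} (vneg x) = rad_int n f {0..} x"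
    using x by (simp add: rad_int_def even)
  then show ?thesis by (simp add: Kf_norm_def)
qed

text \<open>Ball's theorem. Zero vectors are treated apart because their radial integral is
  infinite.\<close>

lemma N_triangle:
  assumes xy: "x \<in> Rn n" "y \<in> Rn n"
  shows "N (vadd x y) \<le> N x + N y"
proof -
  consider "x = vzero" | "y = vzero" | "vadd x y = vzero" | "x \<noteq> vzero" "y \<noteq> vzero" "vadd x y \<noteq> vzero" by blast
  then show ?thesis
  proof cases
    case 1 then have "vadd x y = y" by (auto simp: vec_defs)
    then show ?thesis using 1 by simp
  next
    case 2 then have "vadd x y = x" by (auto simp: vec_defs)
    then show ?thesis using 2 by simp
  next
    case 3 then show ?thesis using N_nonneg by simp
  next
    case 4
    have sum: "vadd x y \<in> Rn n" using xy by simp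
    show ?thesis
      unfolding N_nonzero[OF xy(1) 4(1)] N_nonzero[OF xy(2) 4(2)] N_nonzero[OF sum 4(3)] rad_int_eq
      by (rule Ball_inequality[OF n ray_profile_f ray_profile_f nonneg ray_profile_measurable[OF ray_profile_f] f_harmonic])
        (use xy 4 rad_int_finite in \<open>auto simp flip: rad_int_eq\<close>)
  qed
qed

lemma N_abs_diff:
  assumes xy: "x \<in> Rn n" "y \<in> Rn n"
  shows "\<bar>N x - N y\<bar> \<le> N (vdiff x y)"
proof -
  have "vadd y (vdiff x y) = x" "vadd x (vneg (vdiff x y)) = y" by (auto simp: vec_defs)
  then show ?thesis
    using N_triangle[of y "vdiff x y"] N_triangle[of x "vneg (vdiff x y)"] N_vneg[of "vdiff x y"] xy by auto
qed

text \<open>For x in the box, f \<ge> c on the whole segment from 0 to x, so the radial integral is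
  at least c/n and N at most c^(-1/n); homogeneity does the rest.\<close>

lemma N_le_sum:
  obtains D where "D > 0" "\<And>x. x \<in> Rn n \<Longrightarrow> N x \<le> D * (\<Sum>i<n. \<bar>x i\<bar>)"
proof -
  obtain \<delta> c where \<delta>: "\<delta> > 0" "c > 0"
    "\<And>x. x \<in> Rn n \<Longrightarrow> (\<And>i. i < n \<Longrightarrow> \<bar>x i\<bar> \<le> \<delta>) \<Longrightarrow> c \<le> f x"
    using box_lower_bound by metis
  define D where "D = c powr (- 1 / n)"
  have D: "D > 0" using \<delta> by (simp add: D_def)
  have box: "N x \<le> D" if x: "x \<in> Rn n" "x \<noteq> vzero" "\<And>i. i < n \<Longrightarrow> \<bar>x i\<bar> \<le> \<delta>" for x
  proof -
    have "c \<le> f (vscale r x)" if "0 \<le> r" "r \<le> 1" for r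
      using antimono_ray[of x r 1] \<delta>(3)[of x] x that by (auto simp: vec_defs)
    then have "(\<integral>\<^sup>+r\<in>{0..1}. ennreal (c * r ^ (n - 1)) \<partial>lborel) \<le> rad_int n f {0..1} x"
      unfolding rad_int_def nn_integral_completion
      by (intro nn_integral_mono) (auto simp: indicator_def intro!: ennreal_leI mult_right_mono)
    then have "ennreal (c / n) \<le> rad_int n f {0..} x"
      using nn_integral_power_unit_interval[of n c] n \<delta> rad_int_unit_mono[of x] by (auto intro: order_trans)
    from enn2real_mono[OF this] have "c / n \<le> enn2real (rad_int n f {0..} x)"
      using \<delta> rad_int_finite[OF x(1,2)] by (simp add: less_top)
    then have "c \<le> n * enn2real (rad_int n f {0..} x)" using n by (simp add: field_simps)
    then show ?thesis unfolding N_nonzero[OF x(1,2)] D_def using \<delta> by (intro powr_mono2') auto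
  qed
  show ?thesis
  proof (rule that[of "D / \<delta>"])
    fix x assume x: "x \<in> Rn n"
    show "N x \<le> D / \<delta> * (\<Sum>i<n. \<bar>x i\<bar>)"
    proof (cases "x = vzero")
      case False
      define s where "s = (\<Sum>i<n. \<bar>x i\<bar>)"
      have xs: "\<bar>x i\<bar> \<le> s" if "i < n" for i
        using member_le_sum[of i "{..<n}" "\<lambda>i. \<bar>x i\<bar>"] that by (simp add: s_def)
      obtain j where "j < n" "x j \<noteq> 0" using nonzero_coordinate[OF x False] .
      then have s: "s > 0" using xs[of j] by auto
      have "N (vscale (\<delta> / s) x) \<le> D"
      proof (rule box)
        show "vscale (\<delta> / s) x \<noteq> vzero" using False s \<delta> by (auto simp: vec_defs fun_eq_iff)
        show "\<bar>vscale (\<delta> / s) x i\<bar> \<le> \<delta>" if "i < n" for i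
          using xs[OF that] s \<delta> by (simp add: vscale_def abs_mult field_simps)
      qed (use x in simp)
      then show ?thesis using N_scale[OF x, of "\<delta> / s"] s \<delta> by (simp add: field_simps flip: s_def)
    next
      case True
      then show ?thesis using D \<delta> by (simp add: sum_nonneg)
    qed
  qed (use D \<delta> in simp)
qed

text \<open>Rescaling to |x_j| = 1 makes the uniform bound \<open>Q\<close> on the radial integral
  applicable, and an upper bound there is a lower bound for N.\<close>

lemma coordinate_le_N:
  obtains q where "q > 0" "\<And>x j. x \<in> Rn n \<Longrightarrow> j < n \<Longrightarrow> q * \<bar>x j\<bar> \<le> N x"
proof -
  obtain Q where Q: "Q > 0" "\<And>x j. x \<in> Rn n \<Longrightarrow> j < n \<Longrightarrow> 1 \<le> \<bar>x j\<bar> \<Longrightarrow> rad_int n f {0..} x \<le> ennreal Q"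
    using rad_int_uniform_bound by metis
  define q where "q = (n * Q) powr (- 1 / n)"
  show ?thesis
  proof (rule that[of q])
    show "q > 0" using Q n by (simp add: q_def)
    fix x j assume x: "x \<in> Rn n" "j < n"
    show "q * \<bar>x j\<bar> \<le> N x"
    proof (cases "x j = 0")
      case False
      let ?y = "vscale (1 / \<bar>x j\<bar>) x"
      have y: "?y \<in> Rn n" "?y \<noteq> vzero" "\<bar>?y j\<bar> = 1"
        using x False by (simp, auto simp: vec_defs fun_eq_iff)
      have "enn2real (rad_int n f {0..} ?y) \<le> Q"
        using enn2real_mono[OF Q(2)[OF y(1) x(2)]] y Q(1) by simp
      then have "q \<le> N ?y" unfolding q_def N_nonzero[OF y(1,2)]
        using rad_int_pos[OF y(1,2)] n by (intro powr_mono2') auto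
      then show ?thesis using N_scale[OF x(1), of "1 / \<bar>x j\<bar>"] False by (simp add: field_simps)
    qed (simp add: N_nonneg)
  qed
qed

text \<open>The topology is the product topology, so coordinates converge separately; N is Lipschitz
  for the sum of the first n of them.\<close>

lemma continuous_on_N: "continuous_on (Rn n) N"
proof -
  obtain D where D: "D > 0" "\<And>x. x \<in> Rn n \<Longrightarrow> N x \<le> D * (\<Sum>i<n. \<bar>x i\<bar>)"
    using N_le_sum by metis
  show ?thesis
    unfolding continuous_on_def
  proof
    fix x assume x: "x \<in> Rn n"
    have "((\<lambda>y. y i) \<longlongrightarrow> x i) (at x within Rn n)" for i
      using continuous_on_subset[OF continuous_on_product_coordinates[of i], of "Rn n"] x by (simp add: continuous_on_def)
    then have "((\<lambda>y. D * (\<Sum>i<n. \<bar>y i - x i\<bar>)) \<longlongrightarrow> D * (\<Sum>i<n. \<bar>x i - x i\<bar>)) (at x within Rn n)"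
      by (intro tendsto_intros)
    then have lim: "((\<lambda>y. D * (\<Sum>i<n. \<bar>y i - x i\<bar>)) \<longlongrightarrow> 0) (at x within Rn n)" by simp
    have "\<bar>N y - N x\<bar> \<le> D * (\<Sum>i<n. \<bar>y i - x i\<bar>)" if "y \<in> Rn n" for y
    proof -
      have "N (vdiff y x) \<le> D * (\<Sum>i<n. \<bar>vdiff y x i\<bar>)" using D(2) that x by simp
      then show ?thesis using N_abs_diff[OF that x] by (simp add: vdiff_def)
    qed
    then have "\<forall>\<^sub>F y in at x within Rn n. norm (N y - N x) \<le> D * (\<Sum>i<n. \<bar>y i - x i\<bar>)"
      by (auto simp: eventually_at_filter)
    from Lim_null_comparison[OF this lim] show "(N \<longlongrightarrow> N x) (at x within Rn n)"
      by (simp add: LIM_zero_iff)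
  qed
qed

text \<open>\<open>coordinate_le_N\<close> places the set in a product of compact intervals, with
  singletons {0} beyond n; this product is compact by Tychonoff, and continuity of N makes the
  subset closed.\<close>

lemma compact_Kf: "compact (Kf n f)"
proof -
  obtain q where q: "q > 0" "\<And>x j. x \<in> Rn n \<Longrightarrow> j < n \<Longrightarrow> q * \<bar>x j\<bar> \<le> N x"
    using coordinate_le_N by metis
  define B where "B = (\<Pi>\<^sub>E i\<in>(UNIV::nat set). if i < n then {- (1 / q) .. 1 / q} else {0::real})"
  have B: "compact B"
  proof -
    have "compactin (product_topology (\<lambda>i. euclidean) UNIV) B"
      unfolding B_def compactin_PiE by auto
    then show ?thesis by (simp add: euclidean_product_topology)
  qed
  have BRn: "B \<subseteq> Rn n"
    by (auto simp: B_def Rn_def PiE_iff) (metis leD singletonD)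
  have "closed B" using B by (rule compact_imp_closed)
  moreover have "continuous_on B N" using continuous_on_subset[OF continuous_on_N BRn] .
  ultimately have "closed {x \<in> B. N x \<le> 1}"
    by (intro continuous_closed_preimage[of B N "{..1}", unfolded vimage_def Int_def, simplified])
  then have "compact (B \<inter> {x \<in> B. N x \<le> 1})" using B by (rule compact_Int_closed[rotated])
  moreover have "B \<inter> {x \<in> B. N x \<le> 1} = Kf n f"
  proof -
    have "x \<in> B" if "x \<in> Rn n" "N x \<le> 1" for x
    proof -
      have "\<bar>x j\<bar> \<le> 1 / q" if "j < n" for j
        using q(2)[OF \<open>x \<in> Rn n\<close> that] \<open>N x \<le> 1\<close> q(1) by (simp add: field_simps)
      then have "x j \<in> {- (1 / q) .. 1 / q}" if "j < n" for j using that by (force simp: abs_le_iff)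
      then show ?thesis using that by (auto simp: B_def PiE_iff Rn_def)
    qed
    then show ?thesis using BRn by (auto simp: Kf_def)
  qed
  ultimately show ?thesis by simp
qed

lemma symmetric_convex_body_Kf: "symmetric_convex_body n (Kf n f)"
  unfolding symmetric_convex_body_def
proof (intro conjI ballI allI impI; (elim conjE)?)
  show "Kf n f \<subseteq> Rn n" by (auto simp: Kf_def)
  show "compact (Kf n f)" by (rule compact_Kf)
  show "vneg x \<in> Kf n f" if "x \<in> Kf n f" for x using that N_vneg by (auto simp: Kf_def)
  show "vadd (vscale (1 - t) x) (vscale t y) \<in> Kf n f"
    if xy: "x \<in> Kf n f" "y \<in> Kf n f" and t: "0 \<le> t" "t \<le> 1" for x y t
  proof -
    have R: "x \<in> Rn n" "y \<in> Rn n" "N x \<le> 1" "N y \<le> 1" using xy by (auto simp: Kf_def)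
    have "N (vadd (vscale (1 - t) x) (vscale t y)) \<le> (1 - t) * N x + t * N y"
      using N_triangle[of "vscale (1 - t) x" "vscale t y"] R t by (simp add: N_scale)
    also have "\<dots> \<le> 1" using R t convex_bound_le[of "N x" 1 "N y" "1 - t" t] by auto
    finally show ?thesis using R by (simp add: Kf_def)
  qed
  obtain D where D: "D > 0" "\<And>x. x \<in> Rn n \<Longrightarrow> N x \<le> D * (\<Sum>i<n. \<bar>x i\<bar>)"
    using N_le_sum by metis
  show "\<exists>e>0. \<forall>x\<in>Rn n. enorm n x < e \<longrightarrow> x \<in> Kf n f"
  \<comment> \<open>The radius combines N x \<le> D times the coordinate sum with the bound of that
    sum by n times the Euclidean norm.\<close>
  proof (intro exI[of _ "1 / (D * n)"] conjI ballI impI)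
    show "1 / (D * n) > 0" using D n by simp
    fix x assume x: "x \<in> Rn n" "enorm n x < 1 / (D * n)"
    have "\<bar>x i\<bar> \<le> enorm n x" if "i < n" for i
    proof -
      have "(x i)\<^sup>2 \<le> (\<Sum>i<n. (x i)\<^sup>2)" using that by (intro member_le_sum) auto
      then show ?thesis unfolding enorm_def by (metis real_sqrt_abs real_sqrt_le_iff)
    qed
    then have "(\<Sum>i<n. \<bar>x i\<bar>) \<le> n * enorm n x"
      using sum_bounded_above[of "{..<n}" "\<lambda>i. \<bar>x i\<bar>" "enorm n x"] by auto
    then have "D * (\<Sum>i<n. \<bar>x i\<bar>) \<le> D * (n * enorm n x)" using D by (intro mult_left_mono) auto
    also have "\<dots> \<le> 1" using x(2) D n by (simp add: field_simps)
    finally show "x \<in> Kf n f" using D(2)[OF x(1)] x(1) by (simp add: Kf_def)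
  qed
qed

end

section \<open>The radial map\<close>

context even_log_concave_density
begin

definition radial_factor :: "(nat \<Rightarrow> real) \<Rightarrow> real" where
  "radial_factor x = (n * enn2real (rad_int n f {0..1} x)) powr (1 / n)"

lemma radial_factor_pos: "x \<in> Rn n \<Longrightarrow> radial_factor x > 0"
  using rad_int_unit_pos[of x] n by (simp add: radial_factor_def)

text \<open>Dividing by the gauge multiplies by (n times the whole radial integral)^(1/n), which
  cancels the denominator under the root.\<close>

lemma Tf_eq:
  assumes x: "x \<in> Rn n"
  shows "Tf n f x = vscale (radial_factor x) x"
proof (cases "x = vzero")
  case False
  define \<phi> \<rho> where "\<phi> = enn2real (rad_int n f {0..1} x)" and "\<rho> = enn2real (rad_int n f {0..} x)"
  have pos: "\<phi> > 0" "\<rho> > 0" using rad_int_unit_pos[OF x] rad_int_pos[OF x False] by (auto simp: \<phi>_def \<rho>_def)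
  have "(\<phi> / \<rho>) powr (1 / n) / (n * \<rho>) powr (- 1 / n) = (\<phi> / \<rho>) powr (1 / n) * (n * \<rho>) powr (1 / n)"
    by (simp add: powr_minus_divide)
  also have "\<dots> = (n * \<phi>) powr (1 / n)"
    using pos n by (subst powr_mult[symmetric]) (auto simp: field_simps)
  finally show ?thesis
    using False by (simp add: Tf_def N_nonzero[OF x] radial_factor_def \<phi>_def \<rho>_def)
qed (simp add: Tf_def vec_defs)

lemma radial_factor_le: "x \<in> Rn n \<Longrightarrow> radial_factor x \<le> f vzero powr (1 / n)"
proof -
  assume x: "x \<in> Rn n"
  from enn2real_mono[OF rad_int_unit_le[OF x]] have "enn2real (rad_int n f {0..1} x) \<le> f vzero / n"
    using zero_pos by simp
  then have "n * enn2real (rad_int n f {0..1} x) \<le> f vzero" using n by (simp add: field_simps)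
  then show ?thesis unfolding radial_factor_def by (intro powr_mono2) auto
qed

text \<open>The integral over [0,1] is at most the whole one. In other words N(T x) \<le> 1: the map
  takes its values in K_f.\<close>

lemma radial_factor_N_le_1:
  assumes x: "x \<in> Rn n"
  shows "radial_factor x * N x \<le> 1"
proof (cases "x = vzero")
  case False
  have "radial_factor x \<le> (n * enn2real (rad_int n f {0..} x)) powr (1 / n)"
    unfolding radial_factor_def using enn2real_mono[OF rad_int_unit_mono] rad_int_finite[OF x False]
    by (intro powr_mono2 mult_left_mono) (auto simp: less_top)
  also have "\<dots> = 1 / N x" unfolding N_nonzero[OF x False] by (simp add: powr_minus_divide)
  finally show ?thesis using N_pos[OF x False] by (simp add: field_simps)
qed simp

text \<open>The norm attached in the same way (still with exponent n) to the log-concave function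
  f(x) 1(|u| <= 1) of (x, u) equals 1 / radial_factor x at (x, 1) and N x at (x, 0); the lemma is
  its triangle inequality.\<close>

lemma inverse_radial_factor_triangle:
  assumes xy: "x \<in> Rn n" "y \<in> Rn n" "x \<noteq> y"
  shows "1 / radial_factor x \<le> 1 / radial_factor y + N (vdiff x y)"
proof -
  have d: "vdiff x y \<in> Rn n" "vdiff x y \<noteq> vzero" using xy by (simp, auto simp: vec_defs fun_eq_iff)
  have sum: "vadd y (vdiff x y) = x" by (auto simp: vec_defs)
  have inv: "1 / radial_factor z = (n * enn2real (ray_integral n (unit_ray z))) powr (- 1 / n)" for z
    by (simp add: radial_factor_def rad_int_unit_eq powr_minus_divide)
  show ?thesis unfolding inv N_nonzero[OF d] rad_int_eq
  proof (rule Ball_inequality[OF n ray_profile_unit_ray[OF xy(2)] ray_profile_f[OF d(1)] _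
        ray_profile_measurable[OF ray_profile_unit_ray[OF xy(1)]]])
    show "unit_ray x r \<ge> 0" for r using nonneg by (simp add: unit_ray_def)
    fix r s :: real assume rs: "r > 0" "s > 0"
    \<comment> \<open>The cut-off at 1 is inherited: if the point on the ray of (y, 1) has r \<le>
      1, so does the resulting point on the ray of (x, 1). The direction x - y has last coordinate 0
      and hence no cut-off.\<close>
    have "r * s / (r + s) \<le> r" using rs by (simp add: field_simps)
    then show "unit_ray y r powr (s / (r + s)) * f (vscale s (vdiff x y)) powr (r / (r + s)) \<le> unit_ray x (r * s / (r + s))"
      using f_harmonic[OF xy(2) d(1) rs] nonneg by (auto simp: unit_ray_def sum)
  qed (use rad_int_unit_finite[of x] rad_int_unit_finite[of y] rad_int_finite[OF d] xy in
      \<open>auto simp flip: rad_int_eq rad_int_unit_eq\<close>)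
qed

lemma Tf_Lipschitz:
  assumes x: "x \<in> Rn n" and y: "y \<in> Rn n"
  shows "N (vdiff (Tf n f x) (Tf n f y)) \<le> 2 * f vzero powr (1 / n) * N (vdiff x y)"
proof (cases "x = y")
  case True
  then have "vdiff (Tf n f x) (Tf n f y) = vzero" by (auto simp: vec_defs)
  then show ?thesis using N_nonneg by simp
next
  case False
  let ?d = "N (vdiff x y)"
  have ap: "radial_factor x > 0" "radial_factor y > 0" using radial_factor_pos x y by auto
  have sym: "N (vdiff y x) = ?d"
  proof -
    have "vdiff y x = vneg (vdiff x y)" by (auto simp: vec_defs)
    then show ?thesis using N_vneg[of "vdiff x y"] x y by simp
  qed
  have "\<bar>1 / radial_factor y - 1 / radial_factor x\<bar> \<le> ?d"
    using inverse_radial_factor_triangle[OF x y False] inverse_radial_factor_triangle[OF y x] False sym by auto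
  then have "radial_factor x * radial_factor y * \<bar>1 / radial_factor y - 1 / radial_factor x\<bar> \<le> radial_factor x * radial_factor y * ?d" using ap by (intro mult_left_mono) auto
  moreover have "radial_factor x * radial_factor y * \<bar>1 / radial_factor y - 1 / radial_factor x\<bar> = \<bar>radial_factor x - radial_factor y\<bar>"
  proof -
    have "radial_factor x * radial_factor y * \<bar>1 / radial_factor y - 1 / radial_factor x\<bar> = \<bar>radial_factor x * radial_factor y * (1 / radial_factor y - 1 / radial_factor x)\<bar>" using ap by (simp add: abs_mult)
    also have "radial_factor x * radial_factor y * (1 / radial_factor y - 1 / radial_factor x) = radial_factor x - radial_factor y" using ap by (simp add: field_simps)
    finally show ?thesis .
  qed
  ultimately have diff: "\<bar>radial_factor x - radial_factor y\<bar> \<le> radial_factor x * radial_factor y * ?d" by simp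
  have abs: "N (vscale c y) = \<bar>c\<bar> * N y" for c
  proof (cases "c \<ge> 0")
    case False
    have "vscale c y = vneg (vscale (- c) y)" by (auto simp: vec_defs)
    then show ?thesis using N_vneg[of "vscale (- c) y"] N_scale[OF y, of "- c"] y False by simp
  qed (use N_scale[OF y] in auto)
  have "vdiff (Tf n f x) (Tf n f y) = vadd (vscale (radial_factor x) (vdiff x y)) (vscale (radial_factor x - radial_factor y) y)"
    unfolding Tf_eq[OF x] Tf_eq[OF y] by (auto simp: vec_defs algebra_simps)
  then have "N (vdiff (Tf n f x) (Tf n f y)) \<le> N (vscale (radial_factor x) (vdiff x y)) + N (vscale (radial_factor x - radial_factor y) y)"
    using N_triangle x y by simp
  also have "\<dots> = radial_factor x * ?d + \<bar>radial_factor x - radial_factor y\<bar> * N y" using x y ap by (simp add: N_scale abs)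
  also have "\<bar>radial_factor x - radial_factor y\<bar> * N y \<le> radial_factor x * radial_factor y * ?d * N y"
    using diff N_nonneg by (intro mult_right_mono) auto
  also have "radial_factor x * radial_factor y * ?d * N y = (radial_factor x * ?d) * (radial_factor y * N y)" by (simp add: ac_simps)
  \<comment> \<open>N(T y) \<le> 1 absorbs the factor N(y), which is unbounded in y.\<close>
  also have "\<dots> \<le> (radial_factor x * ?d) * 1"
    using radial_factor_N_le_1[OF y] ap N_nonneg by (intro mult_left_mono) auto
  finally have "N (vdiff (Tf n f x) (Tf n f y)) \<le> 2 * (radial_factor x * ?d)" by simp
  also have "radial_factor x * ?d \<le> f vzero powr (1 / n) * ?d"
    using radial_factor_le[OF x] N_nonneg by (intro mult_right_mono) auto
  finally show ?thesis by simp
qed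

end

theorem theorem3:
  "\<exists>C>0. \<forall>n::nat. \<forall>f :: (nat \<Rightarrow> real) \<Rightarrow> real.
     n \<ge> 1 \<and>
     (\<forall>x. f x \<ge> 0) \<and>
     (\<integral>\<^sup>+ x. ennreal (f x) \<partial>lebesgue_n n) = 1 \<and>
     (\<forall>x\<in>Rn n. f (vneg x) = f x) \<and>
     log_concave_on n f
     \<longrightarrow> symmetric_convex_body n (Kf n f) \<and>
         (\<forall>x\<in>Rn n. \<forall>y\<in>Rn n.
            Kf_norm n f (vdiff (Tf n f x) (Tf n f y))
              \<le> C * f vzero powr (1 / real n) * Kf_norm n f (vdiff x y))"
proof (intro exI[of _ 2] conjI[of "(2::real) > 0"] allI impI)
  fix n :: nat and f :: "(nat \<Rightarrow> real) \<Rightarrow> real"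
  assume "n \<ge> 1 \<and> (\<forall>x. f x \<ge> 0) \<and> (\<integral>\<^sup>+ x. ennreal (f x) \<partial>lebesgue_n n) = 1 \<and>
     (\<forall>x\<in>Rn n. f (vneg x) = f x) \<and> log_concave_on n f"
  then interpret even_log_concave_density n f by unfold_locales auto
  show "symmetric_convex_body n (Kf n f) \<and>
         (\<forall>x\<in>Rn n. \<forall>y\<in>Rn n.
            Kf_norm n f (vdiff (Tf n f x) (Tf n f y))
              \<le> 2 * f vzero powr (1 / real n) * Kf_norm n f (vdiff x y))"
    using symmetric_convex_body_Kf Tf_Lipschitz by blast
qed simp

end
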